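(* For every $d,\alpha \in (0,1]$ there exist an integer $n_0$ and a real $\rho>0$ such that the following holds for all $n \geq n_0$. Let $H$ be an $n$-vertex $(\rho,d)$-cherry-dense $3$-graph satisfying $\delta(H) \geq \alpha \binom{n-1}{2}$. Then $H$ has a tight Hamilton cycle.
   Context: A $3$-graph is a $3$-uniform hypergraph. For a vertex $v$ of $H$, $\deg_H(v)$ is the number of edges of $H$ containing $v$, and $\delta(H)=\min_v \deg_H(v)$. For $G_1,G_2 \subseteq V(H)\times V(H)$ let $\mathcal{P}_2(G_1,G_2)=\{(x,y,z)\in V(H)^3 : (x,y)\in G_1,\ (y,z)\in G_2\}$ and $e_H(G_1,G_2)=|\{(x,y,z)\in \mathcal{P}_2(G_1,G_2): \{x,y,z\}\in E(H)\}|$. For $d,\rho\in(0,1]$, an $n$-vertex $3$-graph $H$ is $(\rho,d)$-cherry-dense if $e_H(G_1,G_2)\geq d|\mathcal{P}_2(G_1,G_2)|-\rho n^3$ for all $G_1,G_2\subseteq V(H)\times V(H)$. A tight Hamilton cycle of $H$ is a cyclic ordering of all vertices of $H$ such that every $3$ cyclically consecutive vertices form an edge of $H$. *)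

theory Defs
  imports Complex_Main
begin

text \<open>A 3-graph is given by its vertex set \<open>V\<close> and its edge set \<open>E\<close>.\<close>

definition three_graph :: "'a set \<Rightarrow> 'a set set \<Rightarrow> bool" where
  "three_graph V E \<longleftrightarrow> finite V \<and> (\<forall>e\<in>E. e \<subseteq> V \<and> card e = 3)"

definition degree :: "'a set set \<Rightarrow> 'a \<Rightarrow> nat" where
  "degree E v = card {e \<in> E. v \<in> e}"

text \<open>Only meaningful for finite nonempty \<open>V\<close>.\<close>

definition min_degree :: "'a set \<Rightarrow> 'a set set \<Rightarrow> nat" where
  "min_degree V E = Min (degree E ` V)"

definition cherries :: "'a set \<Rightarrow> ('a \<times> 'a) set \<Rightarrow> ('a \<times> 'a) set \<Rightarrow> ('a \<times> 'a \<times> 'a) set" where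
  "cherries V G1 G2 = {(x, y, z) \<in> V \<times> V \<times> V. (x, y) \<in> G1 \<and> (y, z) \<in> G2}"

definition cherry_edges ::
  "'a set \<Rightarrow> 'a set set \<Rightarrow> ('a \<times> 'a) set \<Rightarrow> ('a \<times> 'a) set \<Rightarrow> nat" where
  "cherry_edges V E G1 G2 = card {(x, y, z) \<in> cherries V G1 G2. {x, y, z} \<in> E}"

text \<open>The ranges of \<open>\<rho>\<close> and \<open>d\<close> are imposed where the definition is used.\<close>

definition cherry_dense :: "real \<Rightarrow> real \<Rightarrow> 'a set \<Rightarrow> 'a set set \<Rightarrow> bool" where
  "cherry_dense \<rho> d V E \<longleftrightarrow>
     (\<forall>G1 G2. G1 \<subseteq> V \<times> V \<longrightarrow> G2 \<subseteq> V \<times> V \<longrightarrow>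
        real (cherry_edges V E G1 G2)
          \<ge> d * real (card (cherries V G1 G2)) - \<rho> * real (card V) ^ 3)"

text \<open>A cyclic ordering of \<open>V\<close> is represented by a list that enumerates \<open>V\<close> without
  repetition and whose indices are read modulo its length.\<close>

definition tight_hamilton_cycle :: "'a set \<Rightarrow> 'a set set \<Rightarrow> 'a list \<Rightarrow> bool" where
  "tight_hamilton_cycle V E xs \<longleftrightarrow> distinct xs \<and> set xs = V \<and>
     (\<forall>i < length xs.
        {xs ! i, xs ! ((i + 1) mod length xs), xs ! ((i + 2) mod length xs)} \<in> E)"

end

theory Submission
  imports Defs "HOL-Library.Sublist"
begin

text \<open>
  Absorption without regularity or probability. Cherry density is used only in the following form
  (\<open>few_bad\<close>): if every \<open>b\<close> carries a set \<open>f b\<close> of linear size, then for all but few pairs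
  \<open>(b, c)\<close> a proportion \<open>d / 2\<close> of the vertices of \<open>f b\<close> forms an edge with \<open>{b, c}\<close>.
  Taking \<open>f\<close> constant, almost all pairs have many neighbours in any prescribed linear-sized set \<open>U\<close>;
  applying it from both ends of a middle pair connects almost any two pairs through four vertices of
  \<open>U\<close>; and taking \<open>f b\<close> to be the neighbourhood of \<open>b\<close> in the link of \<open>v\<close> yields
  \<open>\<Omega>(n\<^sup>4)\<close> absorbers of \<open>v\<close>.

  Since the connecting property holds in every linear-sized set, an arbitrary small set \<open>R\<close> serves as
  reservoir. A path with linearly many absorbers for every vertex is built greedily, choosing each
  absorber so that the potential \<open>\<Sum>v. 2 ^ - (number of absorbers of v)\<close> drops by a constant factor.
  A maximal extension of it by paths of constant length, joined through \<open>R\<close>, misses few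
  vertices outside \<open>R\<close>; it is closed through \<open>R\<close>, and the missing vertices are absorbed.
\<close>

subsection \<open>Tight paths and absorption\<close>

fun tight_path :: "'a set set \<Rightarrow> 'a list \<Rightarrow> bool" where
  "tight_path E (x # y # z # zs) \<longleftrightarrow> {x, y, z} \<in> E \<and> tight_path E (y # z # zs)"
| "tight_path E _ \<longleftrightarrow> True"

text \<open>Every three consecutive vertices lie in one of the two halves, because these share the
  pair \<open>a, b\<close>. Paths are glued and cut by this rule throughout.\<close>

lemma tight_path_append:
  "tight_path E (xs @ a # b # ys) \<longleftrightarrow> tight_path E (xs @ [a, b]) \<and> tight_path E (a # b # ys)"
proof (induction xs)
  case (Cons x xs)
  then show ?case by (cases xs; cases "tl xs") auto
qed auto

lemma tight_path_nth:
  "tight_path E xs \<Longrightarrow> i + 2 < length xs \<Longrightarrow> {xs ! i, xs ! (i + 1), xs ! (i + 2)} \<in> E"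
proof (induction E xs arbitrary: i rule: tight_path.induct)
  case (1 E x y z zs)
  then show ?case by (cases i) auto
qed auto

text \<open>Repeating the first two vertices at the end makes the cyclic condition linear: position
  \<open>j\<close> of the longer list is position \<open>j mod length xs\<close> of
  \<open>xs\<close>.\<close>

lemma tight_hamilton_cycleI:
  assumes "distinct xs" "tight_path E (xs @ take 2 xs)" "2 \<le> length xs"
  shows "tight_hamilton_cycle (set xs) E xs"
proof -
  have "(xs @ take 2 xs) ! j = xs ! (j mod length xs)" if "j < length xs + 2" for j
    using that assms(3) by (auto simp: nth_append le_mod_geq)
  then show ?thesis
    using tight_path_nth[OF assms(2)] assms by (fastforce simp: tight_hamilton_cycle_def)
qed

text \<open>Inserting \<open>v\<close> between \<open>b\<close> and \<open>c\<close> keeps both end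
  pairs of the block, so no edge outside the block is affected.\<close>

definition absorbs :: "'a set set \<Rightarrow> 'a \<Rightarrow> 'a \<times> 'a \<times> 'a \<times> 'a \<Rightarrow> bool" where
  "absorbs E v = (\<lambda>(a, b, c, e). tight_path E [a, b, v, c, e])"

definition list4 :: "'a \<times> 'a \<times> 'a \<times> 'a \<Rightarrow> 'a list" where
  "list4 = (\<lambda>(a, b, c, e). [a, b, c, e])"

lemma list4_simp [simp]: "list4 (a, b, c, e) = [a, b, c, e]"
  by (simp add: list4_def)

text \<open>A contiguous block disjoint from the nonempty \<open>us\<close> can neither meet nor
  straddle it, so it lies inside \<open>as\<close> or inside \<open>bs\<close>. This keeps the other
  absorbers contiguous when one of them is used.\<close>

lemma sublist_insert_disjoint:
  assumes "sublist ts (as @ us @ bs)" "set ts \<inter> set us = {}" "us \<noteq> []"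
  shows "sublist ts (as @ vs @ bs)"
proof -
  have 1: "x2 = []" if "ts = x1 @ x2" "prefix x2 (us @ bs)" for x1 x2
    using that assms(2,3) by (cases x2; cases us) auto
  have 2: "x1 = []" if "ts = x1 @ x2" "suffix x1 us" for x1 x2
    using that assms(2) set_mono_suffix[of x1 us] by (cases x1) auto
  have 3: "ts = []" if "sublist ts us"
    using that assms(2) set_mono_sublist[of ts us] by (cases ts) auto
  have "sublist ts as \<or> sublist ts bs"
    using assms(1) unfolding sublist_append
  proof (elim disjE exE conjE)
    fix x1 x2 assume "ts = x1 @ x2" "suffix x1 as" "prefix x2 (us @ bs)"
    with 1[of x1 x2] show ?thesis by auto
  next
    fix x1 x2 assume "ts = x1 @ x2" "suffix x1 us" "prefix x2 bs"
    with 2[of x1 x2] show ?thesis by auto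
  qed (use 3 in auto)
  then show ?thesis
    by (auto simp: sublist_append)
qed

lemma absorb_all:
  assumes "finite L" "finite \<T>"
    and "distinct xs" "tight_path E (xs @ take 2 xs)" "set xs \<inter> L = {}"
    and "\<And>T. T \<in> \<T> \<Longrightarrow> sublist (list4 T) xs"
    and "\<And>T T'. T \<in> \<T> \<Longrightarrow> T' \<in> \<T> \<Longrightarrow> T \<noteq> T' \<Longrightarrow> set (list4 T) \<inter> set (list4 T') = {}"
    and "\<And>v. v \<in> L \<Longrightarrow> card L \<le> card {T \<in> \<T>. absorbs E v T}"
  shows "\<exists>ys. distinct ys \<and> tight_path E (ys @ take 2 ys) \<and> set ys = set xs \<union> L"
  using assms
proof (induction L arbitrary: xs \<T> rule: finite_induct)
  case (insert v L)
  have "{T \<in> \<T>. absorbs E v T} \<noteq> {}"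
    using insert.prems(7)[of v] insert.hyps by force
  then obtain a b c e where T: "(a, b, c, e) \<in> \<T>" "absorbs E v (a, b, c, e)"
    by (metis (no_types, lifting) empty_Collect_eq prod_cases4)
  obtain as bs where xs: "xs = as @ [a, b, c, e] @ bs"
    using insert.prems(5)[OF T(1)] by (auto simp: sublist_def)
  define ys where "ys = as @ [a, b, v, c, e] @ bs"
  \<comment> \<open>The new vertex comes after \<open>a\<close> and \<open>b\<close>, hence not
    among the first two, so the pair through which the cycle closes is unchanged.\<close>
  have take: "take 2 xs = take 2 ys"
    unfolding xs ys_def by (cases as; cases "tl as") auto
  have "tight_path E (ys @ take 2 ys)"
    using insert.prems(3) T(2) take
      tight_path_append[of E "as" a b "c # e # bs @ take 2 ys"]
      tight_path_append[of E "as" a b "v # c # e # bs @ take 2 ys"]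
      tight_path_append[of E "[a, b, v]" c e "bs @ take 2 ys"]
      tight_path_append[of E "[a, b]" c e "bs @ take 2 ys"]
    by (simp add: xs ys_def absorbs_def)
  moreover have "distinct ys" "set ys \<inter> L = {}"
    using insert.prems insert.hyps by (auto simp: xs ys_def)
  moreover have "sublist (list4 T') ys" if "T' \<in> \<T> - {(a, b, c, e)}" for T'
    using sublist_insert_disjoint[of "list4 T'" "as" "[a, b, c, e]" bs "[a, b, v, c, e]"]
      insert.prems(5)[of T'] insert.prems(6)[of T' "(a, b, c, e)"] T that
    by (auto simp: xs ys_def)
  moreover have "card L \<le> card {T' \<in> \<T> - {(a, b, c, e)}. absorbs E w T'}" if "w \<in> L" for w
  proof -
    define A where "A = {T' \<in> \<T>. absorbs E w T'}"
    have "Suc (card L) \<le> card A"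
      using insert.prems(7)[of w] that insert.hyps by (simp add: A_def)
    then have "card L \<le> card (A - {(a, b, c, e)})"
      using diff_card_le_card_Diff[of "{(a, b, c, e)}" A] by simp
    also have "A - {(a, b, c, e)} = {T' \<in> \<T> - {(a, b, c, e)}. absorbs E w T'}"
      by (auto simp: A_def)
    finally show ?thesis .
  qed
  ultimately obtain zs where "distinct zs" "tight_path E (zs @ take 2 zs)" "set zs = set ys \<union> L"
    using insert.IH[of "\<T> - {(a, b, c, e)}" ys] insert.prems by auto
  then show ?case
    by (intro exI[of _ zs]) (auto simp: xs ys_def)
qed auto

subsection \<open>Averaging\<close>

text \<open>A reverse Markov bound: light terms add at most \<open>s\<close> each, so a large sum
  forces many heavy terms.\<close>

lemma sum_le_heavy:
  fixes g :: "'a \<Rightarrow> real"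
  assumes "finite A" "\<And>a. a \<in> A \<Longrightarrow> g a \<le> m" "0 \<le> s"
  shows "sum g A \<le> m * card {a \<in> A. s \<le> g a} + s * card A"
proof -
  have "sum g A \<le> (\<Sum>a\<in>A. (if s \<le> g a then m else 0) + s)"
    using assms by (intro sum_mono) (auto simp: add_increasing2)
  also have "\<dots> = m * card {a \<in> A. s \<le> g a} + s * card A"
    using assms(1) by (simp add: sum.distrib sum.If_cases Int_def)
  finally show ?thesis .
qed

lemma markov_card:
  fixes k :: real
  assumes "finite A" "\<And>a. a \<in> A \<Longrightarrow> finite (f a)"
  shows "k * card {a \<in> A. k \<le> card (f a)} \<le> card (Sigma A f)"
proof -
  have "k * card {a \<in> A. k \<le> card (f a)} = (\<Sum>a\<in>{a \<in> A. k \<le> card (f a)}. k)" by simp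
  also have "\<dots> \<le> (\<Sum>a\<in>{a \<in> A. k \<le> card (f a)}. real (card (f a)))"
    by (intro sum_mono) auto
  also have "\<dots> \<le> (\<Sum>a\<in>A. real (card (f a)))"
    using assms by (intro sum_mono2) auto
  finally show ?thesis using assms by simp
qed

text \<open>Averaging replaces a random choice: each weight is halved by at least a fraction
  \<open>c\<close> of all \<open>T\<close>, so the mean new total is at most \<open>1 - c/2\<close>
  times the old one.\<close>

lemma exists_halving:
  fixes w :: "'v \<Rightarrow> real" and c :: real
  assumes "finite W" "finite X" "X \<noteq> {}" "\<And>v. v \<in> W \<Longrightarrow> 0 \<le> w v"
    and many: "\<And>v. v \<in> W \<Longrightarrow> c * card X \<le> card {T \<in> X. P v T}"
  shows "\<exists>T\<in>X. (\<Sum>v\<in>W. w v * (if P v T then 1/2 else 1)) \<le> (1 - c/2) * sum w W"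
proof (rule ccontr)
  assume "\<not> ?thesis"
  then have *: "(1 - c/2) * sum w W < (\<Sum>v\<in>W. w v * (if P v T then 1/2 else 1))" if "T \<in> X" for T
    using that by force
  have "card X * ((1 - c/2) * sum w W) = (\<Sum>T\<in>X. (1 - c/2) * sum w W)" by simp
  also have "\<dots> < (\<Sum>T\<in>X. \<Sum>v\<in>W. w v * (if P v T then 1/2 else 1))"
    using * assms by (intro sum_strict_mono) auto
  also have "\<dots> = (\<Sum>v\<in>W. w v * (\<Sum>T\<in>X. if P v T then 1/2 else 1))"
    by (subst sum.swap) (simp add: sum_distrib_left)
  also have "\<dots> \<le> (\<Sum>v\<in>W. w v * (card X * (1 - c/2)))"
  proof (intro sum_mono mult_left_mono)
    fix v assume v: "v \<in> W"
    have "(\<Sum>T\<in>X. if P v T then 1/2 else 1) = (\<Sum>T\<in>X. 1 - (if P v T then 1/2 else (0::real)))"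
      by (intro sum.cong) auto
    also have "\<dots> = card X - card {T \<in> X. P v T} / 2"
      using assms by (simp add: sum_subtractf sum.If_cases Int_def)
    also have "\<dots> \<le> card X * (1 - c/2)" using many[OF v] by (simp add: algebra_simps)
    finally show "(\<Sum>T\<in>X. if P v T then 1/2 else 1) \<le> card X * (1 - c/2)" .
  qed (use assms in auto)
  also have "\<dots> = card X * ((1 - c/2) * sum w W)"
    by (simp add: sum_distrib_right[symmetric] mult_ac)
  finally show False by simp
qed

subsection \<open>Connecting pairs in cherry-dense graphs\<close>

locale cherry_graph =
  fixes V :: "'a set" and E :: "'a set set" and d \<rho> :: real
  assumes graph: "three_graph V E" and dense: "cherry_dense \<rho> d V E"
    and d: "0 < d" "d \<le> 1" and rho: "0 \<le> \<rho>"
begin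

abbreviation n :: real where "n \<equiv> real (card V)"

definition nb :: "'a \<Rightarrow> 'a \<Rightarrow> 'a set" where
  "nb x y = {z. {x, y, z} \<in> E}"

lemma finV [simp]: "finite V"
  using graph by (simp add: three_graph_def)

lemma edgeD:
  assumes "{x, y, z} \<in> E"
  shows "x \<in> V" "y \<in> V" "z \<in> V" "x \<noteq> y" "y \<noteq> z" "x \<noteq> z"
proof -
  have "{x, y, z} \<subseteq> V" "card {x, y, z} = 3"
    using graph assms by (auto simp: three_graph_def)
  then show "x \<in> V" "y \<in> V" "z \<in> V" "x \<noteq> y" "y \<noteq> z" "x \<noteq> z"
    by (auto simp: card_insert_if split: if_splits)
qed

lemma nb_subset: "nb x y \<subseteq> V"
  using edgeD by (auto simp: nb_def)

lemma finite_nb [simp]: "finite (nb x y)"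
  using nb_subset finV by (rule finite_subset)

section \<open>Exceptional pairs and rich pairs\<close>

text \<open>Cherry density is applied to \<open>G\<close> and to the bad set \<open>M\<close>
  itself. Every pair in \<open>M\<close> falls short of its share \<open>d * card (f b)\<close> by
  at least \<open>d / 2 * s\<close>, while the total deficit is at most
  \<open>\<rho> * n ^ 3\<close>.\<close>

lemma few_bad:
  fixes s :: real
  assumes f: "\<And>b. f b \<subseteq> V" and s: "0 < s"
  shows "card {(b, c) \<in> V \<times> V. s \<le> card (f b) \<and> card (f b \<inter> nb b c) < d / 2 * s}
    \<le> 2 * \<rho> * n ^ 3 / (d * s)"
proof -
  define M where "M = {(b, c) \<in> V \<times> V. s \<le> card (f b) \<and> card (f b \<inter> nb b c) < d / 2 * s}"
  define G where "G = {(a, b). b \<in> V \<and> a \<in> f b}"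
  define \<phi> where "\<phi> = (\<lambda>((b, c), a). (a, b, c :: 'a) :: 'a \<times> 'a \<times> 'a)"
  have M: "M \<subseteq> V \<times> V" by (auto simp: M_def)
  then have finM: "finite M" by (rule finite_subset) simp
  have finf: "finite (f b)" for b using f finV by (rule finite_subset)
  have inj: "inj_on \<phi> X" for X by (auto simp: \<phi>_def inj_on_def)
  have "cherries V G M = \<phi> ` Sigma M (\<lambda>(b, c). f b)"
    using f M by (force simp: cherries_def G_def \<phi>_def image_iff split: prod.splits)
  then have 1: "real (card (cherries V G M)) = (\<Sum>(b, c)\<in>M. card (f b))"
    using finM finf by (simp add: card_image[OF inj] case_prod_unfold)
  have "{(x, y, z) \<in> cherries V G M. {x, y, z} \<in> E} = \<phi> ` Sigma M (\<lambda>(b, c). f b \<inter> nb b c)"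
    using f M by (force simp: cherries_def G_def \<phi>_def image_iff nb_def insert_commute split: prod.splits)
  then have 2: "real (cherry_edges V E G M) = (\<Sum>(b, c)\<in>M. card (f b \<inter> nb b c))"
    using finM finf unfolding cherry_edges_def by (simp add: card_image[OF inj] case_prod_unfold)
  have "G \<subseteq> V \<times> V" using f by (auto simp: G_def)
  then have "d * card (cherries V G M) - \<rho> * n ^ 3 \<le> cherry_edges V E G M"
    using dense M by (simp add: cherry_dense_def)
  then have "(\<Sum>(b, c)\<in>M. d * card (f b) - card (f b \<inter> nb b c)) \<le> \<rho> * n ^ 3"
    unfolding 1 2 by (simp add: sum_subtractf sum_distrib_left case_prod_unfold)
  moreover have "(\<Sum>(b, c)\<in>M. d / 2 * s) \<le> (\<Sum>(b, c)\<in>M. d * card (f b) - card (f b \<inter> nb b c))"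
  proof (intro sum_mono, clarify)
    fix b c assume "(b, c) \<in> M"
    then have "s \<le> card (f b)" "card (f b \<inter> nb b c) < d / 2 * s" by (auto simp: M_def)
    moreover have "d * s \<le> d * card (f b)" using calculation(1) d by simp
    ultimately show "d / 2 * s \<le> d * card (f b) - card (f b \<inter> nb b c)" by linarith
  qed
  ultimately have "card M * (d / 2 * s) \<le> \<rho> * n ^ 3"
    by (simp add: case_prod_unfold)
  then have "card M \<le> \<rho> * n ^ 3 / (d / 2 * s)"
    using d s by (simp only: pos_le_divide_eq mult_pos_pos half_gt_zero)
  then show ?thesis by (simp add: M_def mult_ac)
qed

definition low :: "'a set \<Rightarrow> ('a \<times> 'a) set" where
  "low U = {(x, y) \<in> V \<times> V. card (U \<inter> nb x y) < d / 2 * card U}"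

definition ext :: "'a set \<Rightarrow> 'a \<Rightarrow> 'a \<Rightarrow> 'a set" where
  "ext U x y = {z \<in> U \<inter> nb x y. (y, z) \<notin> low U}"

text \<open>A path leaves the pair through \<open>y\<close>, and many of its next vertices in
  \<open>U\<close> allow a further step. The notion is oriented: \<open>(x, y)\<close> and
  \<open>(y, x)\<close> may differ.\<close>

definition rich :: "'a set \<Rightarrow> ('a \<times> 'a) set" where
  "rich U = {(x, y) \<in> V \<times> V. d / 4 * card U \<le> card (ext U x y)}"

lemma finite_low [simp]: "finite (low U)"
  by (rule finite_subset[of _ "V \<times> V"]) (auto simp: low_def)

lemma card_low:
  assumes "U \<subseteq> V" "0 < \<gamma>" "0 < n" "\<gamma> * n \<le> card U"
  shows "card (low U) \<le> 2 * \<rho> / (d * \<gamma>) * n ^ 2"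
proof -
  have U: "0 < real (card U)" using assms mult_pos_pos[of \<gamma> n] by linarith
  have "card (low U) \<le> 2 * \<rho> * n ^ 3 / (d * card U)"
    using few_bad[of "\<lambda>_. U" "card U"] assms U by (simp add: low_def)
  also have "\<dots> \<le> 2 * \<rho> * n ^ 3 / (d * (\<gamma> * n))"
    using assms d rho U by (intro divide_left_mono mult_left_mono mult_pos_pos) auto
  also have "\<dots> = 2 * \<rho> / (d * \<gamma>) * n ^ 2"
    using assms by (simp add: power2_eq_square power3_eq_cube)
  finally show ?thesis .
qed

text \<open>A pair outside \<open>low U\<close> has \<open>d / 2 * card U\<close> extensions, and it
  loses at least half of that number only if its second vertex lies in \<open>Y\<close>. Markov's
  inequality bounds \<open>Y\<close> through \<open>low U\<close>.\<close>

lemma card_not_rich: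
  assumes "U \<subseteq> V" "0 < \<gamma>" "\<gamma> \<le> 1" "0 < n" "\<gamma> * n \<le> card U"
  shows "card (V \<times> V - rich U) \<le> 10 * \<rho> / (d\<^sup>2 * \<gamma>\<^sup>2) * n ^ 2"
proof -
  define Y where "Y = {y \<in> V. d / 4 * card U \<le> card {z \<in> V. (y, z) \<in> low U}}"
  have U: "0 < real (card U)" using assms mult_pos_pos[of \<gamma> n] by linarith
  have finU: "finite U" using assms(1) finV by (rule finite_subset)
  have "V \<times> V - rich U \<subseteq> low U \<union> V \<times> Y"
  proof (rule subrelI, rule ccontr)
    fix x y assume "(x, y) \<in> V \<times> V - rich U" "(x, y) \<notin> low U \<union> V \<times> Y"
    then have *: "x \<in> V" "y \<in> V" "(x, y) \<notin> rich U" "y \<notin> Y" "(x, y) \<notin> low U" by auto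
    then have "d / 2 * card U \<le> card (U \<inter> nb x y)" using * by (auto simp: low_def)
      also have "U \<inter> nb x y \<subseteq> ext U x y \<union> {z \<in> V. (y, z) \<in> low U}"
        using nb_subset by (auto simp: ext_def)
      then have "card (U \<inter> nb x y) \<le> card (ext U x y) + card {z \<in> V. (y, z) \<in> low U}"
        using finU by (intro order.trans[OF card_mono card_Un_le]) (auto simp: ext_def)
      finally show False using * by (auto simp: Y_def rich_def)
  qed
  then have "card (V \<times> V - rich U) \<le> card (low U) + card (V \<times> Y)"
    by (intro order.trans[OF card_mono card_Un_le]) (auto simp: Y_def)
  then have "card (V \<times> V - rich U) \<le> card (low U) + n * card Y"
    unfolding card_cartesian_product by (simp flip: of_nat_mult of_nat_add)
  moreover have "card Y \<le> 4 / (d * \<gamma> * n) * card (low U)"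
  proof -
    have "d / 4 * card U * card Y \<le> card (Sigma V (\<lambda>y. {z \<in> V. (y, z) \<in> low U}))"
      unfolding Y_def by (intro markov_card) auto
    also have "Sigma V (\<lambda>y. {z \<in> V. (y, z) \<in> low U}) = low U" by (auto simp: low_def)
    finally have "d / 4 * card U * card Y \<le> card (low U)" .
    moreover have "d / 4 * (\<gamma> * n) * card Y \<le> d / 4 * card U * card Y"
      using assms d by (intro mult_right_mono mult_left_mono) auto
    ultimately have "d / 4 * (\<gamma> * n) * card Y \<le> card (low U)" by linarith
    then show ?thesis using assms d by (simp add: field_simps)
  qed
  ultimately have "card (V \<times> V - rich U) \<le> card (low U) + n * (4 / (d * \<gamma> * n) * card (low U))"
    using mult_left_mono[of "card Y" "4 / (d * \<gamma> * n) * card (low U)" n] by linarith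
  also have "\<dots> = (1 + 4 / (d * \<gamma>)) * card (low U)"
    using assms d by (cases "V = {}") (auto simp: field_simps)
  \<comment> \<open>Since \<open>d * \<gamma> \<le> 1\<close>, the summand 1 is at most
    \<open>1 / (d * \<gamma>)\<close>; the factors 5 and 2 give the constant 10.\<close>
  also have "\<dots> \<le> (1 / (d * \<gamma>) + 4 / (d * \<gamma>)) * (2 * \<rho> / (d * \<gamma>) * n ^ 2)"
    using assms d rho card_low[of U \<gamma>] by (intro mult_mono add_right_mono) (auto simp: mult_le_one)
  also have "\<dots> = 10 * \<rho> / (d\<^sup>2 * \<gamma>\<^sup>2) * n ^ 2"
    by (simp add: power2_eq_square add_divide_distrib[symmetric] mult_ac)
  finally show ?thesis .
qed

text \<open>Double counting of the pairs \<open>(a, b)\<close> in \<open>U - F\<close> with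
  \<open>x y a b\<close> tight: \<open>d / 8 * card U\<close> choices of \<open>a\<close> survive
  the removal of \<open>F\<close>, each with \<open>d / 4 * card U\<close> choices of
  \<open>b\<close>. Counting by \<open>b\<close> instead gives many \<open>b\<close> with many
  \<open>a\<close>.\<close>

lemma rich_fan:
  assumes U: "U \<subseteq> V" "U \<noteq> {}" and F: "card (F \<inter> U) \<le> d / 8 * card U" and xy: "(x, y) \<in> rich U"
  defines "f \<equiv> \<lambda>b. {a \<in> U - F. a \<in> nb x y \<and> b \<in> nb y a}"
  shows "d\<^sup>2 / 64 * card U \<le> card {b \<in> U - F. d\<^sup>2 / 64 * card U \<le> card (f b)}"
proof -
  define W where "W = U - F"
  define Z where "Z = ext U x y - F"
  have fin: "finite U" "finite W" "finite Z"
    using finite_subset[OF U(1) finV] by (auto simp: W_def Z_def ext_def)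
  have u: "0 < real (card U)" using U fin by (simp add: card_gt_0_iff)
  have "card (ext U x y) \<le> card Z + card (F \<inter> U)"
    using fin by (intro order.trans[OF card_mono card_Un_le]) (auto simp: Z_def ext_def)
  then have Z: "d / 8 * card U \<le> card Z"
    using F xy by (auto simp: rich_def)
  have N: "d / 4 * card U \<le> card (nb y a \<inter> W)" if "a \<in> Z" for a
  proof -
    have "(y, a) \<notin> low U" "y \<in> V" "a \<in> V"
      using that xy U by (auto simp: Z_def ext_def rich_def)
    then have "d / 2 * card U \<le> card (U \<inter> nb y a)" by (auto simp: low_def)
    also have "card (U \<inter> nb y a) \<le> card (nb y a \<inter> W) + card (F \<inter> U)"
      using fin by (intro order.trans[OF card_mono card_Un_le]) (auto simp: W_def)
    finally have "d / 2 * card U \<le> card (nb y a \<inter> W) + card (F \<inter> U)" by simp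
    moreover have "0 \<le> d / 8 * card U" using d by simp
    ultimately show ?thesis using F by simp
  qed
  have "d\<^sup>2 / 32 * card U ^ 2 = (d / 8 * card U) * (d / 4 * card U)"
    by (simp add: power2_eq_square)
  also have "\<dots> \<le> card Z * (d / 4 * card U)"
    using Z d by (intro mult_right_mono) auto
  also have "\<dots> \<le> (\<Sum>a\<in>Z. real (card (nb y a \<inter> W)))"
    using sum_mono[of Z "\<lambda>_. d / 4 * card U" "\<lambda>a. real (card (nb y a \<inter> W))"] N by simp
  also have "\<dots> = card (Sigma Z (\<lambda>a. nb y a \<inter> W))" using fin by simp
  also have "\<dots> \<le> card (prod.swap ` Sigma W f)"
    using fin unfolding of_nat_le_iff
    by (intro card_mono) (force simp: f_def W_def Z_def ext_def image_iff)+
  also have "\<dots> = card (Sigma W f)" by (intro arg_cong[of _ _ real] card_image) auto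
  also have "\<dots> = (\<Sum>b\<in>W. real (card (f b)))"
    using fin by (subst card_SigmaI) (auto simp: f_def)
  \<comment> \<open>The threshold is half of the average, so the light \<open>b\<close> account for
    at most half of the pairs.\<close>
  also have "\<dots> \<le> real (card U) * card {b \<in> W. d\<^sup>2 / 64 * card U \<le> card (f b)} + d\<^sup>2 / 64 * card U * card W"
    using fin by (intro sum_le_heavy) (auto simp: f_def intro!: card_mono)
  also have "\<dots> \<le> real (card U) * card {b \<in> W. d\<^sup>2 / 64 * card U \<le> card (f b)} + d\<^sup>2 / 64 * card U * card U"
    using fin by (intro add_left_mono mult_left_mono) (auto simp: W_def intro!: card_mono)
  finally have "card U * (d\<^sup>2 / 64 * card U) \<le> real (card U) * card {b \<in> W. d\<^sup>2 / 64 * card U \<le> card (f b)}"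
    by (simp add: power2_eq_square algebra_simps)
  then show ?thesis using u by (simp add: W_def)
qed

text \<open>The path is built from both ends towards a middle pair. The end pair enters reversed, as
  \<open>(w, z)\<close>, because the fan from that side grows backwards.\<close>

lemma connect:
  assumes U: "U \<subseteq> V" "0 < \<gamma>" "\<gamma> * n \<le> card U" and F: "card (F \<inter> U) \<le> d / 8 * card U"
    and xy: "(x, y) \<in> rich U" and wz: "(w, z) \<in> rich U"
    and rho_small: "\<rho> < d ^ 7 * \<gamma> ^ 3 / 2 ^ 20" and n_large: "256 < d ^ 3 * \<gamma> * n"
  obtains a b c e where "{a, b, c, e} \<subseteq> U - F" "distinct [a, b, c, e]"
    "tight_path E [x, y, a, b, c, e, z, w]"
proof -
  define u where "u = real (card U)"
  define s where "s = d\<^sup>2 / 64 * u"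
  define f where "f = (\<lambda>b. {a \<in> U - F. a \<in> nb x y \<and> b \<in> nb y a})"
  define g where "g = (\<lambda>b. {a \<in> U - F. a \<in> nb w z \<and> b \<in> nb z a})"
  \<comment> \<open>\<open>f b\<close> are the \<open>a\<close> with \<open>x y a b\<close> tight and \<open>g c\<close> the \<open>e\<close> with \<open>c e z w\<close> tight; the middle pair
    \<open>(b, c)\<close> is chosen in \<open>P \<times> Q\<close> outside the exceptional pairs of both.\<close>
  define P where "P = {b \<in> U - F. s \<le> card (f b)}"
  define Q where "Q = {b \<in> U - F. s \<le> card (g b)}"
  define X where "X = {(b, c) \<in> V \<times> V. s \<le> card (f b) \<and> card (f b \<inter> nb b c) < d / 2 * s}"
  define Y where "Y = {(b, c) \<in> V \<times> V. s \<le> card (g b) \<and> card (g b \<inter> nb b c) < d / 2 * s}"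
  have n: "0 < n" using n_large d U zero_less_mult_pos[of "d ^ 3 * \<gamma>" n] by auto
  then have u: "0 < u" using U mult_pos_pos[of \<gamma> n] unfolding u_def by linarith
  then have s: "0 < s" using d by (simp add: s_def)
  have fin: "finite U" using U(1) finV by (rule finite_subset)
  have "X \<subseteq> V \<times> V" "Y \<subseteq> V \<times> V" by (auto simp: X_def Y_def)
  then have fin': "finite P" "finite Q" "finite X" "finite Y" "finite (f b)" "finite (g b)" for b
    using fin finite_subset[of _ "V \<times> V"] by (auto simp: P_def Q_def f_def g_def)
  have "U \<noteq> {}" using u by (auto simp: u_def)
  then have "s \<le> card P" "s \<le> card Q"
    using rich_fan[OF U(1) _ F xy] rich_fan[OF U(1) _ F wz]
    by (auto simp: s_def P_def Q_def f_def g_def u_def)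
  then have "s * s \<le> card (P \<times> Q)"
    using s by (simp add: card_cartesian_product mult_mono)
  moreover have "card X \<le> 2 * \<rho> * n ^ 3 / (d * s)" "card Y \<le> 2 * \<rho> * n ^ 3 / (d * s)"
    using few_bad[of f s] few_bad[of g s] s U by (auto simp: X_def Y_def f_def g_def)
  \<comment> \<open>Both exceptional sets together stay below the number of candidate middle pairs.
    Here \<open>d * s ^ 3\<close> is \<open>d ^ 7 * u ^ 3 / 2 ^ 18\<close>, and the factor 4 turns
    \<open>2 ^ 18\<close> into the \<open>2 ^ 20\<close> of the hypothesis.\<close>
  moreover have "4 * \<rho> * n ^ 3 / (d * s) < s * s"
  proof -
    have "4 * \<rho> * n ^ 3 < d ^ 7 * (\<gamma> * n) ^ 3 / 2 ^ 18"
      using mult_strict_right_mono[OF rho_small, of "n ^ 3"] n by (simp add: power_mult_distrib)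
    also have "\<dots> \<le> d ^ 7 * u ^ 3 / 2 ^ 18"
      using U d n unfolding u_def by (intro divide_right_mono mult_left_mono power_mono) auto
    also have "\<dots> = d * s ^ 3"
      by (simp add: s_def power_mult_distrib power_divide power_mult[symmetric] flip: power_Suc)
    finally show ?thesis
      using d s by (simp add: field_simps power3_eq_cube)
  qed
  ultimately have "card X + card Y < card (P \<times> Q)" by simp
  moreover have "card (X \<union> prod.swap ` Y) \<le> card X + card Y"
    using card_image_le[OF fin'(4), of prod.swap] card_Un_le[of X "prod.swap ` Y"] by linarith
  ultimately have "\<not> P \<times> Q \<subseteq> X \<union> prod.swap ` Y"
    using fin' card_mono[of "X \<union> prod.swap ` Y" "P \<times> Q"] by auto
  then obtain b c where bc: "b \<in> P" "c \<in> Q" "(b, c) \<notin> X" "(c, b) \<notin> Y"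
    by force
  \<comment> \<open>This leaves an \<open>e\<close> different from the chosen \<open>a\<close>; the
    edges exclude all other coincidences.\<close>
  have s2: "2 < d / 2 * s"
  proof -
    have "d ^ 3 * (\<gamma> * n) \<le> d ^ 3 * u" using U d unfolding u_def by (intro mult_left_mono) auto
    then show ?thesis using n_large by (simp add: s_def power2_eq_square power3_eq_cube algebra_simps)
  qed
  have fb: "2 < real (card (f b \<inter> nb b c))" and gc: "2 < real (card (g c \<inter> nb c b))"
    using bc s2 U by (auto simp: P_def Q_def X_def Y_def)
  have "f b \<inter> nb b c \<noteq> {}" using fb by force
  then obtain a where a: "a \<in> f b \<inter> nb b c" by auto
  have "\<not> g c \<inter> nb c b \<subseteq> {a}"
    using gc card_mono[of "{a}" "g c \<inter> nb c b"] by auto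
  then obtain e where e: "e \<in> g c \<inter> nb c b" "e \<noteq> a" by auto
  have edges: "{x, y, a} \<in> E" "{y, a, b} \<in> E" "{a, b, c} \<in> E" "{b, c, e} \<in> E" "{c, e, z} \<in> E" "{e, z, w} \<in> E"
    using a e by (auto simp: f_def g_def nb_def insert_commute)
  show ?thesis
  proof (rule that)
    show "{a, b, c, e} \<subseteq> U - F" using a e bc by (auto simp: f_def g_def P_def Q_def)
    show "distinct [a, b, c, e]" using edgeD[OF edges(3)] edgeD[OF edges(4)] e by auto
    show "tight_path E [x, y, a, b, c, e, z, w]" using edges by simp
  qed
qed

subsection \<open>Absorbers and the absorbing path\<close>

text \<open>\<open>F\<close> stands for vertices already used or reserved. The end pairs lie in
  \<open>G\<close> so that absorbers can later be joined to paths.\<close>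

definition absorbers :: "'a set \<Rightarrow> ('a \<times> 'a) set \<Rightarrow> ('a \<times> 'a \<times> 'a \<times> 'a) set" where
  "absorbers F G = {(a, b, c, e). {a, b, c, e} \<subseteq> V - F \<and> distinct [a, b, c, e] \<and>
     tight_path E [a, b, c, e] \<and> (a, b) \<in> G \<and> (c, e) \<in> G}"

lemma absorbers_subset: "absorbers F G \<subseteq> V \<times> V \<times> V \<times> V"
  by (auto simp: absorbers_def)

lemma finite_absorbers [simp]: "finite (absorbers F G)"
  using absorbers_subset by (rule finite_subset) simp

lemma card_absorbers_le: "card (absorbers F G) \<le> n ^ 4"
proof -
  have "card (absorbers F G) \<le> card (V \<times> V \<times> V \<times> V)"
    using absorbers_subset by (intro card_mono) auto
  then show ?thesis
    by (simp add: card_cartesian_product power4_eq_xxxx mult.assoc flip: of_nat_mult)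
qed

text \<open>At least half of the \<open>\<alpha> / 2 * n ^ 2\<close> ordered link pairs survive as
  middle pairs, and each extends to \<open>(a, e)\<close> in at least
  \<open>(d / 2 * s)\<^sup>2\<close> ways. Discarding \<open>Bad\<close> costs at most half of the
  resulting tuples.\<close>

lemma many_absorbers:
  assumes deg: "\<alpha> / 2 * n ^ 2 \<le> card (Sigma V (nb v))" and \<alpha>: "0 < \<alpha>"
    and rho_small: "\<rho> \<le> d * \<alpha>\<^sup>2 / 512" and n: "0 < n"
    and c: "c = d\<^sup>2 * \<alpha> ^ 3 / 4096" "8 \<le> c * n"
    and G: "card (V \<times> V - G) \<le> c / 16 * n ^ 2" and F: "F \<subseteq> V" "card F \<le> c / 16 * n"
  shows "c / 2 * n ^ 4 \<le> card {T \<in> absorbers F G. absorbs E v T}"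
proof -
  define s where "s = \<alpha> / 16 * n"
  define f where "f = nb v"
  define Z where "Z = Sigma {b \<in> V. card (f b) < s} f"
  \<comment> \<open>An absorber \<open>(a, b, c, e)\<close> is counted from its middle pair \<open>(b, c)\<close>, an edge of the link
    of \<open>v\<close> extending to many \<open>a\<close> and many \<open>e\<close>; \<open>X\<close> collects the pairs that fail.\<close>
  define M where "M = {(b, c) \<in> Sigma V f. s \<le> card (f b) \<and> s \<le> card (f c)}"
  define X where "X = {(b, c) \<in> V \<times> V. s \<le> card (f b) \<and> card (f b \<inter> nb b c) < d / 2 * s}"
  define M' where "M' = M - X - prod.swap ` X"
  define All where "All = Sigma M' (\<lambda>(b, c). (f b \<inter> nb b c) \<times> (f c \<inter> nb c b))"
  define \<psi> where "\<psi> = (\<lambda>((b, c), (a, e)). (a :: 'a, b :: 'a, c :: 'a, e :: 'a))"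
  define B where "B = V \<times> V - G"
  define \<chi> where "\<chi> = (\<lambda>((a, b), (c, e)). (a :: 'a, b :: 'a, c :: 'a, e :: 'a))"
  \<comment> \<open>The tuples lost are those with \<open>a = e\<close>, those meeting
    \<open>F\<close>, and those with an end pair outside \<open>G\<close>. The other coincidences
    cannot occur, since \<open>{a, b, c}\<close> and \<open>{b, c, e}\<close> are edges.\<close>
  define Bad where "Bad = (\<lambda>(a, b, c). (a, b, c, a)) ` (V \<times> V \<times> V) \<union> F \<times> V \<times> V \<times> V \<union>
    V \<times> F \<times> V \<times> V \<union> V \<times> V \<times> F \<times> V \<union> V \<times> V \<times> V \<times> F \<union> \<chi> ` (B \<times> V \<times> V) \<union> \<chi> ` ((V \<times> V) \<times> B)"
  have f: "f b \<subseteq> V" "finite (f b)" for b by (simp_all add: f_def nb_subset)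
  have f_sym: "c \<in> f b \<longleftrightarrow> b \<in> f c" for b c by (simp add: f_def nb_def insert_commute)
  have s: "0 < s" using \<alpha> n by (simp add: s_def)
  have "M \<subseteq> V \<times> V" "X \<subseteq> V \<times> V" "Z \<subseteq> V \<times> V" using f by (auto simp: M_def X_def Z_def)
  then have fin: "finite M" "finite X" "finite Z" "finite F" "finite B"
    using finite_subset[of _ "V \<times> V"] finite_subset[OF F(1)] by (auto simp: B_def)
  then have fin': "finite M'" by (simp add: M'_def)
  have fin_swap: "card (prod.swap ` Y) \<le> card Y" if "finite Y" for Y :: "('a \<times> 'a) set"
    using that by (rule card_image_le)
  have Z: "card Z \<le> s * n"
  proof -
    have "card Z = (\<Sum>b\<in>{b \<in> V. card (f b) < s}. real (card (f b)))"
      using f by (simp add: Z_def)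
    also have "\<dots> \<le> (\<Sum>b\<in>{b \<in> V. card (f b) < s}. s)" by (intro sum_mono) auto
    also have "\<dots> \<le> (\<Sum>b\<in>V. s)" using s by (intro sum_mono2) auto
    finally show ?thesis by (simp add: mult.commute)
  qed
  have "Sigma V f \<subseteq> M' \<union> X \<union> prod.swap ` X \<union> Z \<union> prod.swap ` Z"
  proof (rule subrelI)
    fix b c assume bc: "(b, c) \<in> Sigma V f"
    then have "b \<in> V" "c \<in> V" "c \<in> f b" "b \<in> f c" using f(1)[of b] f_sym[of c b] by auto
    then show "(b, c) \<in> M' \<union> X \<union> prod.swap ` X \<union> Z \<union> prod.swap ` Z"
      by (force simp: M'_def M_def Z_def image_iff)
  qed
  then have "card (Sigma V f) \<le> card (M' \<union> X \<union> prod.swap ` X \<union> Z \<union> prod.swap ` Z)"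
    using fin fin' by (intro card_mono) auto
  also have "\<dots> \<le> card M' + card X + card (prod.swap ` X) + card Z + card (prod.swap ` Z)"
    by (intro order.trans[OF card_Un_le] add_mono order.refl)
  also have "\<dots> \<le> card M' + 2 * card X + 2 * card Z"
    using fin_swap[OF fin(2)] fin_swap[OF fin(3)] by simp
  finally have "real (card (Sigma V f)) \<le> real (card M' + 2 * card X + 2 * card Z)"
    by (simp only: of_nat_le_iff)
  then have "\<alpha> / 2 * n ^ 2 \<le> card M' + 2 * card X + 2 * card Z"
    using deg by (simp add: f_def del: card_SigmaI)
  moreover have "2 * card X \<le> \<alpha> / 8 * n ^ 2"
  proof -
    have "card X \<le> 2 * \<rho> * n ^ 3 / (d * s)" using few_bad[of f s] f s by (simp add: X_def)
    also have "\<dots> = 32 * \<rho> / (d * \<alpha>) * n ^ 2"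
      using n by (simp add: s_def power2_eq_square power3_eq_cube)
    also have "\<dots> \<le> \<alpha> / 16 * n ^ 2"
      using rho_small d \<alpha> by (intro mult_right_mono) (auto simp: field_simps power2_eq_square)
    finally show ?thesis by simp
  qed
  moreover have "2 * card Z \<le> \<alpha> / 8 * n ^ 2" using Z by (simp add: s_def power2_eq_square)
  ultimately have M': "\<alpha> / 4 * n ^ 2 \<le> card M'" by simp
  \<comment> \<open>This is the origin of \<open>c\<close>: the number of middle pairs times the
    number of choices of \<open>(a, e)\<close>, with \<open>s = \<alpha> / 16 * n\<close>.\<close>
  have "c * n ^ 4 = (\<alpha> / 4 * n ^ 2) * (d / 2 * s)\<^sup>2"
    unfolding c s_def by (simp add: field_simps power_mult_distrib power4_eq_xxxx power2_eq_square power3_eq_cube)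
  also have "\<dots> \<le> (\<Sum>_\<in>M'. (d / 2 * s)\<^sup>2)"
    using mult_right_mono[OF M', of "(d / 2 * s)\<^sup>2"] by simp
  also have "\<dots> \<le> (\<Sum>(b, c)\<in>M'. real (card ((f b \<inter> nb b c) \<times> (f c \<inter> nb c b))))"
  proof (intro sum_mono, clarify)
    fix b c assume "(b, c) \<in> M'"
    then have "d / 2 * s \<le> card (f b \<inter> nb b c)" "d / 2 * s \<le> card (f c \<inter> nb c b)"
      using f by (force simp: M'_def M_def X_def image_iff)+
    then have "(d / 2 * s) * (d / 2 * s) \<le> real (card (f b \<inter> nb b c)) * real (card (f c \<inter> nb c b))"
      using d s by (intro mult_mono) auto
    then show "(d / 2 * s)\<^sup>2 \<le> real (card ((f b \<inter> nb b c) \<times> (f c \<inter> nb c b)))"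
      by (simp add: power2_eq_square card_cartesian_product)
  qed
  also have "\<dots> = card All"
    using fin' f unfolding All_def by (subst card_SigmaI) (auto simp: case_prod_unfold)
  also have "card All = card (\<psi> ` All)"
    by (intro card_image[symmetric]) (auto simp: inj_on_def \<psi>_def)
  also have "\<psi> ` All \<subseteq> {T \<in> absorbers F G. absorbs E v T} \<union> Bad"
  proof (clarsimp simp: \<psi>_def All_def)
    fix b c a e assume *: "(b, c) \<in> M'" "a \<in> f b" "a \<in> nb b c" "e \<in> f c" "e \<in> nb c b" "(a, b, c, e) \<notin> Bad"
    have E: "{a, b, v} \<in> E" "{b, v, c} \<in> E" "{v, c, e} \<in> E" "{a, b, c} \<in> E" "{b, c, e} \<in> E"
      using * by (auto simp: f_def nb_def insert_commute M'_def M_def)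
    have V: "a \<in> V" "b \<in> V" "c \<in> V" "e \<in> V" using edgeD[OF E(4)] edgeD[OF E(5)] by auto
    have "(a, b, c, a) \<in> Bad"
      unfolding Bad_def using V by (intro UnI1 image_eqI[of _ _ "(a, b, c)"]) auto
    then have "a \<noteq> e" using *(6) by auto
    moreover have "{a, b, c, e} \<inter> F = {}" using V *(6) by (simp add: Bad_def)
    moreover have "(a, b) \<in> G"
    proof (rule ccontr)
      assume "(a, b) \<notin> G"
      then have "(a, b, c, e) \<in> \<chi> ` (B \<times> V \<times> V)"
        using V by (intro image_eqI[of _ _ "((a, b), (c, e))"]) (simp_all add: B_def \<chi>_def)
      then show False using *(6) by (simp add: Bad_def)
    qed
    moreover have "(c, e) \<in> G"
    proof (rule ccontr)
      assume "(c, e) \<notin> G"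
      then have "(a, b, c, e) \<in> \<chi> ` ((V \<times> V) \<times> B)"
        using V by (intro image_eqI[of _ _ "((a, b), (c, e))"]) (simp_all add: B_def \<chi>_def)
      then show False using *(6) by (simp add: Bad_def)
    qed
    ultimately show "(a, b, c, e) \<in> absorbers F G \<and> absorbs E v (a, b, c, e)"
      using E V edgeD[OF E(4)] edgeD[OF E(5)] by (auto simp: absorbers_def absorbs_def)
  qed
  then have "card (\<psi> ` All) \<le> card {T \<in> absorbers F G. absorbs E v T} + card Bad"
    using fin by (intro order.trans[OF card_mono card_Un_le]) (auto simp: Bad_def)
  moreover have "card Bad \<le> n ^ 3 + 4 * (card F * n ^ 3) + 2 * (card B * n ^ 2)"
  proof -
    have "card Bad \<le> card ((\<lambda>(a, b, c). (a, b, c, a)) ` (V \<times> V \<times> V)) + card (F \<times> V \<times> V \<times> V) +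
      card (V \<times> F \<times> V \<times> V) + card (V \<times> V \<times> F \<times> V) + card (V \<times> V \<times> V \<times> F) +
      card (\<chi> ` (B \<times> V \<times> V)) + card (\<chi> ` ((V \<times> V) \<times> B))"
      unfolding Bad_def by (intro order.trans[OF card_Un_le] add_mono order.refl)
    also have "\<dots> \<le> card (V \<times> V \<times> V) + card (F \<times> V \<times> V \<times> V) +
      card (V \<times> F \<times> V \<times> V) + card (V \<times> V \<times> F \<times> V) + card (V \<times> V \<times> V \<times> F) +
      card (B \<times> V \<times> V) + card ((V \<times> V) \<times> B)"
      using fin by (intro add_mono order.refl card_image_le) auto
    also have "\<dots> = card V ^ 3 + 4 * (card F * card V ^ 3) + 2 * (card B * card V ^ 2)"
      by (simp add: card_cartesian_product power2_eq_square power3_eq_cube)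
    finally have "real (card Bad) \<le> real (card V ^ 3 + 4 * (card F * card V ^ 3) + 2 * (card B * card V ^ 2))"
      by (simp only: of_nat_le_iff)
    then show ?thesis by simp
  qed
  \<comment> \<open>The three terms bounding \<open>Bad\<close> contribute \<open>c / 8\<close>,
    \<open>4 * c / 16\<close> and \<open>2 * c / 16\<close> times \<open>n ^ 4\<close>, together
    \<open>c / 2 * n ^ 4\<close>.\<close>
  moreover have "n ^ 3 \<le> c / 8 * n ^ 4"
    using mult_right_mono[OF c(2), of "n ^ 3"] n by (simp add: power4_eq_xxxx power3_eq_cube)
  moreover have "card F * n ^ 3 \<le> c / 16 * n ^ 4"
    using mult_right_mono[OF F(2), of "n ^ 3"] n by (simp add: power4_eq_xxxx power3_eq_cube)
  moreover have "card B * n ^ 2 \<le> c / 16 * n ^ 4"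
    using mult_right_mono[OF G, of "n ^ 2"] n by (simp add: B_def power4_eq_xxxx power2_eq_square)
  ultimately show ?thesis by simp
qed

section \<open>Growing, joining and closing paths with good ends\<close>

definition good_path :: "('a \<times> 'a) set \<Rightarrow> 'a list \<Rightarrow> bool" where
  "good_path G P \<longleftrightarrow> distinct P \<and> tight_path E P \<and> (\<exists>a b qs. P = a # b # qs \<and> (a, b) \<in> G) \<and>
     (\<exists>ps c e. P = ps @ [c, e] \<and> (c, e) \<in> G)"

text \<open>The condition on \<open>\<eta>\<close> bounds the bad pairs by
  \<open>(d / 8 * card S)\<^sup>2\<close>, so Markov's inequality gives at most
  \<open>d / 8 * card S\<close> vertices in \<open>Y\<close>. Each pair of \<open>D\<close> then has
  more than \<open>d / 4 * card S\<close> continuations within \<open>D\<close>, enough to avoid a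
  path of fewer than \<open>k\<close> vertices.\<close>

lemma long_path:
  assumes S: "S \<subseteq> V" "0 < \<gamma>" "\<gamma> * n \<le> card S" and n: "0 < n"
    and G: "card (V \<times> V - G) \<le> \<eta> * n ^ 2" "\<And>x y. (x, y) \<in> G \<Longrightarrow> (y, x) \<in> G"
    and \<eta>: "\<eta> + 2 * \<rho> / (d * \<gamma>) \<le> d\<^sup>2 * \<gamma>\<^sup>2 / 64"
    and k: "2 \<le> k" "real k \<le> d / 4 * card S"
  shows "\<exists>Q. good_path G Q \<and> length Q = k \<and> set Q \<subseteq> S"
proof -
  define B where "B = (V \<times> V - G) \<union> low S"
  \<comment> \<open>Outside the few vertices of \<open>Y\<close>, which lie in many bad pairs, every good pair has many
    extensions to a good pair, so that a path can be grown greedily.\<close>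
  define Y where "Y = {y \<in> V. d / 8 * card S \<le> card {z \<in> V. (y, z) \<in> B}}"
  define D where "D = {(x, y) \<in> (S - Y) \<times> (S - Y). (x, y) \<notin> B}"
  have finS: "finite S" using S(1) finV by (rule finite_subset)
  have s: "0 < real (card S)" using S n mult_pos_pos[of \<gamma> n] by linarith
  have B: "B \<subseteq> V \<times> V" by (auto simp: B_def low_def)
  have Y: "card Y \<le> d / 8 * card S"
  proof -
    have "d / 8 * card S * card Y \<le> card (Sigma V (\<lambda>y. {z \<in> V. (y, z) \<in> B}))"
      unfolding Y_def by (intro markov_card) auto
    also have "Sigma V (\<lambda>y. {z \<in> V. (y, z) \<in> B}) = B" using B by auto
    also have "real (card B) \<le> card (V \<times> V - G) + card (low S)"
      unfolding B_def using card_Un_le[of "V \<times> V - G" "low S"] by linarith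
    also have "\<dots> \<le> (\<eta> + 2 * \<rho> / (d * \<gamma>)) * n ^ 2"
      using G(1) card_low[OF S(1,2) n S(3)] by (simp add: distrib_right)
    also have "\<dots> \<le> d\<^sup>2 * \<gamma>\<^sup>2 / 64 * n ^ 2" using \<eta> by (intro mult_right_mono) auto
    also have "\<dots> = (d / 8)\<^sup>2 * (\<gamma> * n)\<^sup>2" by (simp add: power_mult_distrib power_divide)
    also have "\<dots> \<le> (d / 8)\<^sup>2 * (real (card S))\<^sup>2"
      using S n by (intro mult_left_mono power_mono) auto
    also have "\<dots> = d / 8 * card S * (d / 8 * card S)" by (simp add: power2_eq_square)
    finally show ?thesis using d s by (simp add: mult_le_cancel_left_pos)
  qed
  have many: "card (A \<inter> S) - d / 4 * card S < card {z \<in> A. (y, z) \<in> D}" if "y \<in> S - Y" "finite A" for y A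
  proof -
    have "A \<inter> S \<subseteq> {z \<in> A. (y, z) \<in> D} \<union> Y \<union> {z \<in> V. (y, z) \<in> B}"
      using that S by (auto simp: D_def)
    then have "card (A \<inter> S) \<le> card ({z \<in> A. (y, z) \<in> D} \<union> Y \<union> {z \<in> V. (y, z) \<in> B})"
      using that by (intro card_mono) (auto simp: Y_def)
    also have "\<dots> \<le> card {z \<in> A. (y, z) \<in> D} + card Y + card {z \<in> V. (y, z) \<in> B}"
      by (intro order.trans[OF card_Un_le] add_mono order.refl)
    finally have "card (A \<inter> S) \<le> card {z \<in> A. (y, z) \<in> D} + card Y + card {z \<in> V. (y, z) \<in> B}" .
    moreover have "card {z \<in> V. (y, z) \<in> B} < d / 8 * card S"
      using that S by (auto simp: Y_def)
    ultimately show ?thesis using Y by linarith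
  qed
  have ext: "d / 4 * card S < card {z \<in> nb x y. (y, z) \<in> D}" if "(x, y) \<in> D" for x y
  proof -
    have "d / 2 * card S \<le> card (nb x y \<inter> S)"
      using that S by (auto simp: D_def B_def low_def Int_commute)
    then show ?thesis using many[of y "nb x y"] that by (auto simp: D_def)
  qed
  obtain x0 y0 where D0: "(x0, y0) \<in> D"
  proof -
    have "\<not> S \<subseteq> Y"
    proof
      assume "S \<subseteq> Y"
      then have "card S \<le> card Y" by (intro card_mono) (auto simp: Y_def)
      moreover have "d / 8 * card S < 1 * real (card S)" using d s by (intro mult_strict_right_mono) auto
      ultimately show False using Y by linarith
    qed
    then obtain y where y: "y \<in> S - Y" by auto
    have "d / 4 * card S \<le> 1 * real (card S)" using d s by (intro mult_right_mono) auto
    then have "0 < real (card {z \<in> S. (y, z) \<in> D})"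
      using many[OF y finS] by simp
    then have "{z \<in> S. (y, z) \<in> D} \<noteq> {}" by force
    then show ?thesis using that by auto
  qed
  have DG: "(x, y) \<in> G" if "(x, y) \<in> D" for x y
    using that S by (auto simp: D_def B_def)
  have loop: "x \<noteq> y" if xy: "(x, y) \<in> D" for x y
  proof -
    have "0 < d * card S" using d s by simp
    then have "0 < real (card {z \<in> nb x y. (y, z) \<in> D})" using ext[OF xy] by linarith
    then have "{z \<in> nb x y. (y, z) \<in> D} \<noteq> {}" by (metis card.empty less_irrefl of_nat_0)
    then obtain z where "z \<in> nb x y" by auto
    then show ?thesis using edgeD[of x y z] by (auto simp: nb_def)
  qed
  \<comment> \<open>The path grows at its head, hence the reversed pair \<open>(b, a)\<close> in
    \<open>D\<close>. The last pair is fixed at the start and only has to remain in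
    \<open>G\<close>.\<close>
  have "\<exists>a b qs ps c e. a # b # qs = ps @ [c, e] \<and> length (a # b # qs) = k \<and> distinct (a # b # qs) \<and>
      tight_path E (a # b # qs) \<and> set (a # b # qs) \<subseteq> S \<and> (b, a) \<in> D \<and> (c, e) \<in> G"
    using k
  proof (induction k rule: dec_induct)
    case base
    have "(y0, x0) \<in> G" using DG[OF D0] G(2) by blast
    then show ?case
      using D0 loop[OF D0] by (intro exI[of _ y0] exI[of _ x0] exI[of _ "[]"]) (auto simp: D_def)
  next
    case (step k)
    have "real k \<le> d / 4 * card S" using step.prems by simp
    from step.IH[OF this] obtain a b qs ps c e where Q: "a # b # qs = ps @ [c, e]" "length (a # b # qs) = k"
      "distinct (a # b # qs)" "tight_path E (a # b # qs)" "set (a # b # qs) \<subseteq> S" "(b, a) \<in> D" "(c, e) \<in> G"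
      by blast
    have "card (set (a # b # qs)) < card {z \<in> nb b a. (a, z) \<in> D}"
      using ext[OF Q(6)] distinct_card[OF Q(3)] Q(2) step.prems by simp
    then have "\<not> {z \<in> nb b a. (a, z) \<in> D} \<subseteq> set (a # b # qs)"
      using card_mono[of "set (a # b # qs)" "{z \<in> nb b a. (a, z) \<in> D}"] by auto
    then obtain z where z: "{b, a, z} \<in> E" "(a, z) \<in> D" "z \<notin> set (a # b # qs)"
      by (auto simp: nb_def)
    have "z # a # b # qs = (z # ps) @ [c, e]" using Q(1) by simp
    moreover have "length (z # a # b # qs) = Suc k" using Q(2) by simp
    moreover have "distinct (z # a # b # qs)" using Q(3) z(3) by simp
    moreover have "tight_path E (z # a # b # qs)" using Q(4) z(1) by (simp add: insert_commute)
    moreover have "set (z # a # b # qs) \<subseteq> S" using Q(5) z(2) by (auto simp: D_def)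
    ultimately show ?case using z(2) Q(7) by blast
  qed
  then obtain a b qs ps c e where "a # b # qs = ps @ [c, e]" "length (a # b # qs) = k"
      "distinct (a # b # qs)" "tight_path E (a # b # qs)" "set (a # b # qs) \<subseteq> S" "(b, a) \<in> D" "(c, e) \<in> G"
    by blast
  moreover have "(a, b) \<in> G" using DG G(2) \<open>(b, a) \<in> D\<close> by blast
  ultimately show ?thesis unfolding good_path_def by blast
qed

text \<open>Symmetry of \<open>G\<close> makes the reversed first pair of \<open>Q\<close> rich, as
  \<open>connect\<close> demands. The outer end pairs are those of \<open>P\<close> and
  \<open>Q\<close>, so the result is good again.\<close>

lemma join_good_paths:
  assumes P: "good_path G P" and Q: "good_path G Q" and PQ: "set P \<inter> set Q = {}"
    and F: "set P \<union> set Q \<subseteq> F" "card (F \<inter> U) \<le> d / 8 * card U"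
    and G: "\<And>x y. (x, y) \<in> G \<Longrightarrow> (y, x) \<in> G" "G \<subseteq> rich U"
    and U: "U \<subseteq> V" "0 < \<gamma>" "\<gamma> * n \<le> card U"
    and rho_small: "\<rho> < d ^ 7 * \<gamma> ^ 3 / 2 ^ 20" and n_large: "256 < d ^ 3 * \<gamma> * n"
  shows "\<exists>M. length M = 4 \<and> set M \<subseteq> U - F \<and> good_path G (P @ M @ Q)"
proof -
  obtain ps x y where x: "P = ps @ [x, y]" "(x, y) \<in> G" using P by (auto simp: good_path_def)
  obtain z w qs where z: "Q = z # w # qs" "(z, w) \<in> G" using Q by (auto simp: good_path_def)
  have "(x, y) \<in> rich U" "(w, z) \<in> rich U" using x z G by auto
  from connect[OF U F(2) this rho_small n_large] obtain a b c e where
    M: "{a, b, c, e} \<subseteq> U - F" "distinct [a, b, c, e]" "tight_path E [x, y, a, b, c, e, z, w]" .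
  define M where "M = [a, b, c, e]"
  have M': "set M \<inter> F = {}" "distinct M" using M by (auto simp: M_def)
  have "tight_path E (P @ M @ Q)"
    using tight_path_append[of E ps x y "M @ Q"] tight_path_append[of E "[x, y, a, b, c, e]" z w qs]
      P Q M x z by (simp add: good_path_def M_def)
  moreover have "distinct (P @ M @ Q)"
    using M' F PQ P Q by (auto simp: good_path_def)
  moreover have "\<exists>a b qs'. P @ M @ Q = a # b # qs' \<and> (a, b) \<in> G"
    using P unfolding good_path_def by (metis append_Cons)
  moreover have "\<exists>ps' c e. P @ M @ Q = ps' @ [c, e] \<and> (c, e) \<in> G"
    using Q unfolding good_path_def by (metis append.assoc)
  ultimately show ?thesis
    using M by (intro exI[of _ M]) (auto simp: good_path_def M_def)
qed

text \<open>\<open>connect\<close> is applied from the last pair of \<open>P\<close> to its own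
  first pair, which is \<open>take 2\<close> of the closed list.\<close>

lemma close_good_path:
  assumes P: "good_path G P" and F: "card (set P \<inter> U) \<le> d / 8 * card U"
    and G: "\<And>x y. (x, y) \<in> G \<Longrightarrow> (y, x) \<in> G" "G \<subseteq> rich U"
    and U: "U \<subseteq> V" "0 < \<gamma>" "\<gamma> * n \<le> card U"
    and rho_small: "\<rho> < d ^ 7 * \<gamma> ^ 3 / 2 ^ 20" and n_large: "256 < d ^ 3 * \<gamma> * n"
  shows "\<exists>M. set M \<subseteq> U \<and> distinct (P @ M) \<and> tight_path E ((P @ M) @ take 2 (P @ M))"
proof -
  obtain ps x y where x: "P = ps @ [x, y]" "(x, y) \<in> G" using P by (auto simp: good_path_def)
  obtain z w qs where z: "P = z # w # qs" "(z, w) \<in> G" using P by (auto simp: good_path_def)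
  have "(x, y) \<in> rich U" "(w, z) \<in> rich U" using x z G by auto
  from connect[OF U F this rho_small n_large] obtain a b c e where
    M: "{a, b, c, e} \<subseteq> U - set P" "distinct [a, b, c, e]" "tight_path E [x, y, a, b, c, e, z, w]" .
  have "take 2 (P @ [a, b, c, e]) = [z, w]" using z by simp
  moreover have "tight_path E (ps @ [x, y])" using P x by (simp add: good_path_def)
  ultimately have "tight_path E ((P @ [a, b, c, e]) @ take 2 (P @ [a, b, c, e]))"
    using tight_path_append[of E ps x y "[a, b, c, e, z, w]"] M by (simp add: x(1))
  then show ?thesis
    using M P by (intro exI[of _ "[a, b, c, e]"]) (auto simp: good_path_def)
qed

text \<open>If \<open>\<gamma> * n\<close> vertices outside \<open>R\<close> were left over,
  \<open>long_path\<close> would supply another block to join, against maximality. The bound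
  \<open>4 \<le> k * (d / 8 * \<gamma>)\<close> keeps the used part of \<open>R\<close> small enough
  for every joint. As a prefix of the cycle, \<open>A\<close> keeps its absorbers intact.\<close>

lemma extend_to_cycle:
  fixes k :: nat
  assumes R: "R \<subseteq> V" "0 < \<gamma>" "\<gamma> * n \<le> card R" and n: "0 < n"
    and G: "card (V \<times> V - G) \<le> \<eta> * n ^ 2" "\<And>x y. (x, y) \<in> G \<Longrightarrow> (y, x) \<in> G" "G \<subseteq> rich R"
    and \<eta>: "\<eta> + 2 * \<rho> / (d * \<gamma>) \<le> d\<^sup>2 * \<gamma>\<^sup>2 / 64"
    and rho_small: "\<rho> < d ^ 7 * \<gamma> ^ 3 / 2 ^ 20" and n_large: "256 < d ^ 3 * \<gamma> * n"
    and k: "2 \<le> k" "k \<le> d / 4 * (\<gamma> * n)" "4 \<le> k * (d / 8 * \<gamma>)"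
    and A: "good_path G A" "set A \<subseteq> V - R"
  shows "\<exists>B. distinct (A @ B) \<and> tight_path E ((A @ B) @ take 2 (A @ B)) \<and> set (A @ B) \<subseteq> V \<and>
    card (V - set (A @ B)) \<le> \<gamma> * n + card R"
proof -
  \<comment> \<open>The last condition charges the at most four vertices of \<open>R\<close> used by a joint to the \<open>k\<close>
    vertices of the joined path: only \<open>4 * n / k\<close> vertices of \<open>R\<close> are ever used.\<close>
  define ok where "ok B \<longleftrightarrow> good_path G (A @ B) \<and> set B \<subseteq> V \<and>
    card (set (A @ B) \<inter> R) * k \<le> 4 * length (A @ B)" for B
  have len: "length (A @ B) \<le> card V" if "ok B" for B
  proof -
    have "distinct (A @ B)" "set (A @ B) \<subseteq> V" using that A by (auto simp: ok_def good_path_def)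
    then show ?thesis using card_mono[OF finV] distinct_card by metis
  qed
  have small: "card (set (A @ B) \<inter> R) \<le> d / 8 * card R" if "ok B" for B
  proof -
    have "card (set (A @ B) \<inter> R) * k \<le> 4 * card V"
      using that len[OF that] unfolding ok_def by linarith
    then have "real (card (set (A @ B) \<inter> R) * k) \<le> real (4 * card V)"
      by (simp only: of_nat_le_iff)
    then have "k * real (card (set (A @ B) \<inter> R)) \<le> 4 * n" by (simp add: mult.commute)
    also have "\<dots> \<le> k * (d / 8 * \<gamma>) * n" using k n by (intro mult_right_mono) auto
    also have "\<dots> = k * (d / 8 * (\<gamma> * n))" by simp
    also have "\<dots> \<le> k * (d / 8 * card R)"
      using d R by (intro mult_left_mono) auto
    finally show ?thesis using k by simp
  qed
  have "set A \<inter> R = {}" using A(2) by auto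
  then have "ok []" using A by (simp add: ok_def)
  moreover have "\<forall>B. ok B \<longrightarrow> length B < Suc (card V)" using len by (metis add_leD2 le_imp_less_Suc length_append)
  ultimately obtain B where B: "ok B" and max: "\<And>B'. ok B' \<Longrightarrow> length B' \<le> length B"
    using ex_has_greatest_nat[of ok "[]" length "Suc (card V)"] by blast
  define P where "P = A @ B"
  have P: "good_path G P" "set P \<subseteq> V" using B A by (auto simp: ok_def P_def)
  define S where "S = V - set P - R"
  have S: "card S < \<gamma> * n"
  proof (rule ccontr)
    assume "\<not> ?thesis"
    then have cS: "\<gamma> * n \<le> card S" by simp
    have "d / 4 * (\<gamma> * n) \<le> d / 4 * card S" using cS d by (intro mult_left_mono) auto
    then have "k \<le> d / 4 * card S" using k by linarith
    from long_path[OF _ R(2) cS n G(1,2) \<eta> k(1) this] obtain Q where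
      Q: "good_path G Q" "length Q = k" "set Q \<subseteq> S" by (auto simp: S_def)
    have "(set P \<union> set Q) \<inter> R = set P \<inter> R" "set P \<inter> set Q = {}" using Q by (auto simp: S_def)
    then obtain M where M: "length M = 4" "set M \<subseteq> R - (set P \<union> set Q)" "good_path G (P @ M @ Q)"
      using join_good_paths[OF P(1) Q(1) _ order.refl _ G(2,3) R rho_small n_large] small[OF B]
      by (auto simp: P_def)
    have "ok (B @ M @ Q)"
      unfolding ok_def
    proof (intro conjI)
      show "good_path G (A @ B @ M @ Q)" using M by (simp add: P_def)
      show "set (B @ M @ Q) \<subseteq> V" using M Q B R by (auto simp: ok_def S_def)
      have "set (A @ B @ M @ Q) \<inter> R \<subseteq> (set (A @ B) \<inter> R) \<union> set M" using Q by (auto simp: S_def)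
      then have "card (set (A @ B @ M @ Q) \<inter> R) \<le> card (set (A @ B) \<inter> R) + card (set M)"
        by (intro order.trans[OF card_mono card_Un_le]) auto
      also have "\<dots> \<le> card (set (A @ B) \<inter> R) + 4" using card_length[of M] M by simp
      finally have "card (set (A @ B @ M @ Q) \<inter> R) * k \<le> (card (set (A @ B) \<inter> R) + 4) * k"
        by (rule mult_le_mono1)
      also have "\<dots> \<le> 4 * length (A @ B) + 4 * k" using B by (simp add: ok_def algebra_simps)
      also have "\<dots> \<le> 4 * length (A @ B @ M @ Q)" using Q by simp
      finally show "card (set (A @ B @ M @ Q) \<inter> R) * k \<le> 4 * length (A @ B @ M @ Q)" .
    qed
    from max[OF this] show False using M by simp
  qed
  obtain M where M: "set M \<subseteq> R" "distinct (P @ M)" "tight_path E ((P @ M) @ take 2 (P @ M))"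
    using close_good_path[OF P(1) _ G(2,3) R rho_small n_large] small[OF B] by (auto simp: P_def)
  have finR: "finite R" using R(1) finV by (rule finite_subset)
  have "V - set (P @ M) \<subseteq> S \<union> R" by (auto simp: S_def)
  then have "card (V - set (P @ M)) \<le> card S + card R"
    using finR by (intro order.trans[OF card_mono card_Un_le]) (auto simp: S_def)
  then have "card (V - set (P @ M)) \<le> \<gamma> * n + card R" using S by linarith
  then show ?thesis
    using M P R(1) by (intro exI[of _ "B @ M"]) (auto simp: P_def)
qed

section \<open>Greedy construction of the absorbing path\<close>

text \<open>A round adds four joining vertices and an absorber chosen by
  \<open>exists_halving\<close>. The bound by \<open>\<phi>\<close> keeps the used and reserved
  vertices few enough for \<open>many\<close> to apply in every round.\<close>

lemma absorbing_path:
  assumes R: "R \<subseteq> V" and n: "0 < n"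
    and G: "\<And>x y. (x, y) \<in> G \<Longrightarrow> (y, x) \<in> G" "G \<subseteq> rich V"
    and rho_small: "\<rho> < d ^ 7 / 2 ^ 20" and n_large: "256 < d ^ 3 * n"
    and c: "0 < c" "c \<le> 1"
    and many: "\<And>F v. F \<subseteq> V \<Longrightarrow> card F \<le> \<phi> * n \<Longrightarrow> v \<in> V \<Longrightarrow>
      c * n ^ 4 \<le> card {T \<in> absorbers F G. absorbs E v T}"
    and size: "8 * real t + 4 + card R \<le> \<phi> * n" "\<phi> * n + 4 \<le> d / 8 * n"
  shows "\<exists>P \<T>. good_path G P \<and> set P \<subseteq> V - R \<and> finite \<T> \<and> length P = 8 * t + 4 \<and>
    (\<forall>T\<in>\<T>. sublist (list4 T) P) \<and>
    (\<forall>T\<in>\<T>. \<forall>T'\<in>\<T>. T \<noteq> T' \<longrightarrow> set (list4 T) \<inter> set (list4 T') = {}) \<and>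
    (\<Sum>v\<in>V. (1/2) ^ card {T \<in> \<T>. absorbs E v T}) \<le> (1 - c / 2) ^ t * n"
  using size(1)
proof (induction t)
  have good: "good_path G (list4 T)" "length (list4 T) = 4" "set (list4 T) \<subseteq> V - F"
    if "T \<in> absorbers F G" for T F
    using that by (auto simp: absorbers_def good_path_def intro: exI[of _ "[_, _]"])
  obtain v where v: "v \<in> V" using n by (cases "V = {}") auto
  have ne: "absorbers F G \<noteq> {}" if "F \<subseteq> V" "card F \<le> \<phi> * n" for F
  proof
    assume "absorbers F G = {}"
    then have "c * n ^ 4 \<le> 0" using many[OF that v] by simp
    moreover have "0 < c * n ^ 4" using c n by (intro mult_pos_pos zero_less_power)
    ultimately show False by linarith
  qed
  {
    case 0
    then have "absorbers R G \<noteq> {}" using R by (intro ne) auto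
    then obtain T where T: "T \<in> absorbers R G" by auto
    \<comment> \<open>The initial block only supplies good end pairs; it is not counted in
      \<open>\<T>\<close>, so the potential starts at \<open>n\<close>.\<close>
    show ?case using good[OF T] by (intro exI[of _ "list4 T"] exI[of _ "{}"]) auto
  next
    case (Suc t)
    have "8 * real t + 4 + card R \<le> \<phi> * n" using Suc.prems by simp
    from Suc.IH[OF this] obtain P \<T> where
      P: "good_path G P" "set P \<subseteq> V - R" "finite \<T>" "length P = 8 * t + 4"
      and sub: "\<forall>T\<in>\<T>. sublist (list4 T) P"
      and disj: "\<forall>T\<in>\<T>. \<forall>T'\<in>\<T>. T \<noteq> T' \<longrightarrow> set (list4 T) \<inter> set (list4 T') = {}"
      and pot: "(\<Sum>v\<in>V. (1/2) ^ card {T \<in> \<T>. absorbs E v T}) \<le> (1 - c / 2) ^ t * n"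
      by blast
    note sub = sub[rule_format] and disj = disj[rule_format]
    define F where "F = set P \<union> R"
    have F: "F \<subseteq> V" using P R by (auto simp: F_def)
    have "card F \<le> 8 * t + 4 + card R"
      unfolding F_def using card_Un_le[of "set P" R] card_length[of P] P(4) by linarith
    then have cF: "card F + 8 \<le> \<phi> * n" using Suc.prems by simp
    define X where "X = absorbers F G"
    have "\<exists>T\<in>X. (\<Sum>v\<in>V. (1/2) ^ card {T \<in> \<T>. absorbs E v T} * (if absorbs E v T then 1/2 else 1))
        \<le> (1 - c/2) * (\<Sum>v\<in>V. (1/2) ^ card {T \<in> \<T>. absorbs E v T})"
    proof (rule exists_halving)
      fix v assume "v \<in> V"
      have "c * card X \<le> c * n ^ 4"
        using c card_absorbers_le[of F G] by (intro mult_left_mono) (auto simp: X_def)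
      also have "\<dots> \<le> card {T \<in> X. absorbs E v T}"
        unfolding X_def using F cF \<open>v \<in> V\<close> by (intro many) auto
      finally show "c * card X \<le> card {T \<in> X. absorbs E v T}" .
    qed (use F cF ne in \<open>auto simp: X_def\<close>)
    then obtain T where T: "T \<in> X" and
      half: "(\<Sum>v\<in>V. (1/2) ^ card {T \<in> \<T>. absorbs E v T} * (if absorbs E v T then 1/2 else 1))
        \<le> (1 - c/2) * (\<Sum>v\<in>V. (1/2) ^ card {T \<in> \<T>. absorbs E v T})" by auto
    note gT = good[OF T[unfolded X_def]]
    have PT: "set P \<inter> set (list4 T) = {}" using gT by (auto simp: F_def)
    have "card ((F \<union> set (list4 T)) \<inter> V) \<le> card (F \<union> set (list4 T))"
      using F finV finite_subset[OF F] by (intro card_mono) auto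
    also have "\<dots> \<le> card F + 4"
      using card_Un_le[of F "set (list4 T)"] card_length[of "list4 T"] gT(2) by linarith
    finally have "card ((F \<union> set (list4 T)) \<inter> V) \<le> d / 8 * n"
      using cF size(2) by linarith
    \<comment> \<open>The joint runs through \<open>U = V\<close> with proportion 1. Since
      \<open>F\<close> contains \<open>R\<close>, the reservoir stays untouched.\<close>
    from join_good_paths[OF P(1) gT(1) PT _ this G order.refl, of 1]
    obtain M where M: "length M = 4" "set M \<subseteq> V - (F \<union> set (list4 T))" "good_path G (P @ M @ list4 T)"
      using rho_small n_large by (auto simp: F_def)
    have new: "set (list4 T) \<inter> set (list4 T') = {}" if "T' \<in> \<T>" for T'
      using PT set_mono_sublist[OF sub[OF that]] by blast
    have "set (list4 T) \<noteq> {}" using gT(2) by (cases "list4 T") simp_all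
    \<comment> \<open>As \<open>T\<close> is new, the absorber count of each \<open>v\<close>
      absorbed by \<open>T\<close> rises by exactly one, which halves its summand.\<close>
    then have "T \<notin> \<T>" using new[of T] by (metis Int_absorb)
    then have card_insert: "card {T' \<in> insert T \<T>. absorbs E v T'} =
        card {T' \<in> \<T>. absorbs E v T'} + (if absorbs E v T then 1 else 0)" for v
    proof (cases "absorbs E v T")
      case True
      then have "{T' \<in> insert T \<T>. absorbs E v T'} = insert T {T' \<in> \<T>. absorbs E v T'}" by auto
      then show ?thesis using True \<open>T \<notin> \<T>\<close> P(3) by simp
    next
      case False
      then have "{T' \<in> insert T \<T>. absorbs E v T'} = {T' \<in> \<T>. absorbs E v T'}" by auto
      then show ?thesis using False by simp
    qed
    have "(\<Sum>v\<in>V. (1/2) ^ card {T' \<in> insert T \<T>. absorbs E v T'})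
      = (\<Sum>v\<in>V. (1/2) ^ card {T \<in> \<T>. absorbs E v T} * (if absorbs E v T then 1/2 else (1::real)))"
      unfolding card_insert by (intro sum.cong) auto
    also note half
    also have "(1 - c/2) * (\<Sum>v\<in>V. (1/2) ^ card {T \<in> \<T>. absorbs E v T}) \<le> (1 - c/2) * ((1 - c / 2) ^ t * n)"
      using pot c by (intro mult_left_mono) auto
    finally have "(\<Sum>v\<in>V. (1/2) ^ card {T' \<in> insert T \<T>. absorbs E v T'}) \<le> (1 - c / 2) ^ Suc t * n"
      by simp
    moreover have "set (P @ M @ list4 T) \<subseteq> V - R" using P(2) M(2) gT(3) by (auto simp: F_def)
    moreover have "sublist (list4 T') (P @ M @ list4 T)" if "T' \<in> insert T \<T>" for T'
    proof (cases "T' = T")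
      case True
      then show ?thesis unfolding sublist_def by (intro exI[of _ "P @ M"] exI[of _ "[]"]) simp
    next
      case False
      then show ?thesis using that sub[of T'] by (simp add: sublist_append)
    qed
    moreover have "set (list4 T1) \<inter> set (list4 T2) = {}"
      if "T1 \<in> insert T \<T>" "T2 \<in> insert T \<T>" "T1 \<noteq> T2" for T1 T2
      using that new disj by (metis Int_commute insert_iff)
    ultimately show ?case
      using M P gT by (intro exI[of _ "P @ M @ list4 T"] exI[of _ "insert T \<T>"]) auto
  }
qed

section \<open>From minimum degree to link pairs\<close>

text \<open>Each edge at \<open>v\<close> yields two ordered pairs of its other vertices, and
  different edges yield disjoint sets of pairs.\<close>

lemma two_degree_le:
  assumes "v \<in> V"
  shows "2 * degree E v \<le> card (Sigma V (nb v))"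
proof -
  define F where "F = (\<lambda>e. {(b, c) \<in> V \<times> V. {v, b, c} = e})"
  have "E \<subseteq> Pow V" using graph by (auto simp: three_graph_def)
  then have finE: "finite {e \<in> E. v \<in> e}" by (simp add: finite_subset)
  have F: "card (F e) = 2" if e: "e \<in> {e \<in> E. v \<in> e}" for e
  proof -
    have "card e = 3" "e \<subseteq> V" using graph e by (auto simp: three_graph_def)
    then have "card (e - {v}) = 2" using e by (simp add: card_Diff_singleton_if)
    then obtain b c where bc: "e - {v} = {b, c}" "b \<noteq> c" unfolding card_2_iff by blast
    then have "e = {v, b, c}" "v \<noteq> b" "v \<noteq> c" using e by auto
    moreover have "(p, q) = (b, c) \<or> (p, q) = (c, b)" if "{v, p, q} = e" for p q
    proof -
      have "b \<in> {v, p, q}" "c \<in> {v, p, q}" using that calculation(1) by auto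
      then show ?thesis using calculation bc(2) by auto
    qed
    ultimately have "F e = {(b, c), (c, b)}"
      using \<open>e \<subseteq> V\<close> by (auto simp: F_def)
    then show ?thesis using bc(2) by simp
  qed
  have "2 * degree E v = (\<Sum>e\<in>{e \<in> E. v \<in> e}. card (F e))"
    using F by (simp add: degree_def)
  also have "\<dots> = card (\<Union>e\<in>{e \<in> E. v \<in> e}. F e)"
    using finE by (intro card_UN_disjoint[symmetric]) (auto simp: F_def intro: finite_subset[of _ "V \<times> V"])
  also have "\<dots> \<le> card (Sigma V (nb v))"
    by (intro card_mono finite_SigmaI finV finite_nb) (auto simp: F_def nb_def)
  finally show ?thesis .
qed

text \<open>From \<open>n = 6\<close> on, \<open>(n - 1) * (n - 2)\<close> is at least
  \<open>n ^ 2 / 2\<close>; counting ordered pairs gains a factor 2.\<close>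

lemma pairs_of_min_degree:
  assumes "\<alpha> * real ((card V - 1) choose 2) \<le> min_degree V E" "0 < \<alpha>" "6 \<le> n" "v \<in> V"
  shows "\<alpha> / 2 * n ^ 2 \<le> card (Sigma V (nb v))"
proof -
  have "real ((card V - 1) choose 2) = (n - 1) * (n - 2) / 2"
    using assms(3) by (simp add: choose_two real_of_nat_div of_nat_diff)
  moreover have "n ^ 2 / 2 \<le> (n - 1) * (n - 2)"
    using mult_right_mono[OF assms(3), of n] by (simp add: algebra_simps power2_eq_square)
  ultimately have "n ^ 2 / 4 \<le> real ((card V - 1) choose 2)" by simp
  then have "\<alpha> * (n ^ 2 / 4) \<le> \<alpha> * real ((card V - 1) choose 2)"
    using assms(2) by (intro mult_left_mono) auto
  moreover have "min_degree V E \<le> degree E v"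
    using assms(4) by (simp add: min_degree_def)
  ultimately have "\<alpha> / 2 * n ^ 2 \<le> real (2 * degree E v)" using assms(1) by simp
  also have "\<dots> \<le> real (card (Sigma V (nb v)))"
    using two_degree_le[OF assms(4)] by (simp only: of_nat_le_iff)
  finally show ?thesis .
qed

section \<open>Assembly of the Hamilton cycle\<close>

text \<open>\<open>c\<close> is the density of absorbers and \<open>\<gamma>\<close> that of the
  reservoir. The choice \<open>\<gamma> = c\<^sup>2 / 8192\<close> makes the supply of absorbers per
  vertex, about \<open>c\<^sup>2 / 1024 * n = 8 * \<gamma> * n\<close>, exceed the at most
  \<open>3 * \<gamma> * n\<close> vertices left over.\<close>

lemma tight_hamilton_cycle_exists:
  fixes \<alpha> :: real
  defines "c \<equiv> d\<^sup>2 * \<alpha> ^ 3 / 4096"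
  defines "\<gamma> \<equiv> c\<^sup>2 / 8192"
  assumes \<alpha>: "0 < \<alpha>" "\<alpha> \<le> 1"
    and deg: "\<alpha> * real ((card V - 1) choose 2) \<le> min_degree V E"
    and rho_small: "\<rho> < d ^ 7 * \<gamma> ^ 3 / 2 ^ 20" "\<rho> \<le> d * \<alpha>\<^sup>2 / 512" "40 * \<rho> \<le> d ^ 4 * \<gamma> ^ 4 / 128"
    and n_large: "256 < d ^ 3 * \<gamma>\<^sup>2 * n" "ln n + 1 < \<gamma> * n"
  shows "\<exists>xs. tight_hamilton_cycle V E xs"
proof -
  have c: "0 < c" using \<alpha> d by (simp add: c_def)
  have "d\<^sup>2 * \<alpha> ^ 3 \<le> d * 1"
    using \<alpha> d by (intro mult_mono) (auto simp: power_le_one power2_eq_square)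
  then have cd: "c \<le> d / 4096" by (simp add: c_def)
  then have c1: "c \<le> 1 / 4096" using d by simp
  have \<gamma>: "0 < \<gamma>" using c by (simp add: \<gamma>_def)
  have "c * c \<le> c * (1 / 4096)" using c c1 by (intro mult_left_mono) auto
  then have \<gamma>c: "\<gamma> \<le> c / 4096" using c by (simp add: \<gamma>_def power2_eq_square)
  then have \<gamma>1: "\<gamma> \<le> 1" using c1 by simp
  have n: "0 < n" using n_large(1) by (cases "V = {}") (auto simp: card_gt_0_iff)
  have scale: "256 < x * n" if "d ^ 3 * \<gamma>\<^sup>2 \<le> x" for x
    using n_large(1) mult_right_mono[OF that, of n] n by linarith
  have d3: "d ^ 3 \<le> d\<^sup>2" "d ^ 3 \<le> d" "d ^ 3 \<le> 1" "d\<^sup>2 \<le> 1" and \<gamma>2: "\<gamma>\<^sup>2 \<le> \<gamma>"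
    using d \<gamma> \<gamma>1 power_decreasing[of 2 3 d] power_decreasing[of 1 3 d] power_decreasing[of 1 2 \<gamma>]
    by (auto simp: power_le_one)
  have d3\<gamma>: "d ^ 3 * \<gamma>\<^sup>2 \<le> \<gamma>"
    using mult_mono[OF d3(3) \<gamma>2] \<gamma> by simp
  have n1: "256 < d ^ 3 * \<gamma> * n" using \<gamma>2 d by (intro scale mult_left_mono) auto
  have n2: "256 < c * n" using d3\<gamma> \<gamma>c c by (intro scale) linarith
  have n3: "256 < d * n" using mult_mono[OF d3(2), of "\<gamma>\<^sup>2" 1] \<gamma> \<gamma>1 d by (intro scale) (auto simp: power_le_one)
  have n4: "256 < d\<^sup>2 * \<gamma>\<^sup>2 * n" using d3 by (intro scale mult_right_mono) auto
  have n5: "256 < \<gamma> * n" using d3\<gamma> by (rule scale)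
  have n6: "256 < n" using scale[of 1] d3\<gamma> \<gamma>1 by simp
  have ceil: "x \<le> nat \<lceil>x\<rceil>" "nat \<lceil>x\<rceil> \<le> x + 1" if "0 \<le> x" for x :: real
    using that real_nat_ceiling_ge[of x] of_int_ceiling_le_add_one[of x] by simp_all
  obtain R where R: "R \<subseteq> V" "\<gamma> * n \<le> card R" "card R \<le> 2 * \<gamma> * n"
  proof -
    define r where "r = nat \<lceil>\<gamma> * n\<rceil>"
    have r: "\<gamma> * n \<le> r" "r \<le> \<gamma> * n + 1" using ceil[of "\<gamma> * n"] \<gamma> n by (simp_all add: r_def)
    have "\<gamma> * n \<le> c / 4096 * n" using \<gamma>c n by (intro mult_right_mono) auto
    moreover have "c * n \<le> 1 * n" using c1 n by (intro mult_right_mono) auto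
    ultimately have "real r \<le> n" using r n6 by linarith
    then have "r \<le> card V" by simp
    then obtain R where "R \<subseteq> V" "card R = r" by (meson obtain_subset_with_card_n)
    then show ?thesis using that r n5 by auto
  qed
  \<comment> \<open>Richness in \<open>V\<close> serves the absorbing path, richness in
    \<open>R\<close> the joints through the reservoir. Both orientations are imposed because
    \<open>rich\<close> is not symmetric.\<close>
  define G where "G = {(x, y) \<in> V \<times> V. (x, y) \<in> rich V \<inter> rich R \<and> (y, x) \<in> rich V \<inter> rich R}"
  have G: "(y, x) \<in> G" if "(x, y) \<in> G" for x y using that by (auto simp: G_def)
  have GV: "G \<subseteq> rich V" and GR: "G \<subseteq> rich R" by (auto simp: G_def)
  define \<eta> where "\<eta> = d\<^sup>2 * \<gamma>\<^sup>2 / 128"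
  have cG: "card (V \<times> V - G) \<le> \<eta> * n ^ 2"
  proof -
    define BV BR where "BV = V \<times> V - rich V" and "BR = V \<times> V - rich R"
    have fin: "finite BV" "finite BR" by (auto simp: BV_def BR_def)
    have "V \<times> V - G \<subseteq> BV \<union> prod.swap ` BV \<union> BR \<union> prod.swap ` BR"
      by (force simp: G_def BV_def BR_def image_iff)
    then have "card (V \<times> V - G) \<le> card (BV \<union> prod.swap ` BV \<union> BR \<union> prod.swap ` BR)"
      using fin by (intro card_mono) auto
    also have "\<dots> \<le> card BV + card (prod.swap ` BV) + card BR + card (prod.swap ` BR)"
      by (intro order.trans[OF card_Un_le] add_mono order.refl)
    also have "\<dots> \<le> 2 * card BV + 2 * card BR"
      using card_image_le[OF fin(1), of prod.swap] card_image_le[OF fin(2), of prod.swap] by simp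
    finally have "card (V \<times> V - G) \<le> 2 * card BV + 2 * card BR" .
    moreover have "card BV \<le> 10 * \<rho> / d\<^sup>2 * n ^ 2"
      using card_not_rich[of V 1] n by (simp add: BV_def)
    moreover have "10 * \<rho> / d\<^sup>2 * n ^ 2 \<le> 10 * \<rho> / (d\<^sup>2 * \<gamma>\<^sup>2) * n ^ 2"
      using rho d \<gamma> \<gamma>1 mult_left_le[of "\<gamma>\<^sup>2" "d\<^sup>2"]
      by (intro mult_right_mono divide_left_mono) (auto simp: power_le_one)
    moreover have "card BR \<le> 10 * \<rho> / (d\<^sup>2 * \<gamma>\<^sup>2) * n ^ 2"
      using card_not_rich[OF R(1) \<gamma> \<gamma>1 n R(2)] by (simp add: BR_def)
    \<comment> \<open>Two reference sets and two orientations, each with the constant 10, give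
      40.\<close>
    ultimately have "card (V \<times> V - G) \<le> 40 * \<rho> / (d\<^sup>2 * \<gamma>\<^sup>2) * n ^ 2" by simp
    also have "\<dots> \<le> d ^ 4 * \<gamma> ^ 4 / 128 / (d\<^sup>2 * \<gamma>\<^sup>2) * n ^ 2"
      using rho_small(3) by (intro mult_right_mono divide_right_mono) auto
    also have "\<dots> = \<eta> * n ^ 2"
      using d \<gamma> by (simp add: \<eta>_def power4_eq_xxxx power2_eq_square)
    finally show ?thesis .
  qed
  have \<eta>: "\<eta> + 2 * \<rho> / (d * \<gamma>) \<le> d\<^sup>2 * \<gamma>\<^sup>2 / 64"
  proof -
    have "2 * \<rho> \<le> d ^ 4 * \<gamma> ^ 4 / 128" using rho_small(3) rho by linarith
    also have "\<dots> \<le> d ^ 3 * \<gamma> ^ 3 / 128"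
      using d \<gamma> \<gamma>1 by (intro divide_right_mono mult_mono power_decreasing) auto
    finally have "2 * \<rho> / (d * \<gamma>) \<le> d\<^sup>2 * \<gamma>\<^sup>2 / 128"
      using d \<gamma> by (simp add: divide_simps power2_eq_square power3_eq_cube mult_ac)
    then show ?thesis unfolding \<eta>_def by linarith
  qed
  have "d\<^sup>2 * \<gamma>\<^sup>2 \<le> 1 * \<gamma>" using d3 \<gamma>2 by (intro mult_mono) auto
  then have "\<eta> \<le> c / 16" unfolding \<eta>_def using \<gamma>c c by linarith
  then have cG': "card (V \<times> V - G) \<le> c / 16 * n ^ 2"
    using cG mult_right_mono[of \<eta> "c / 16" "n ^ 2"] by simp
  have many: "c / 2 * n ^ 4 \<le> card {T \<in> absorbers F G. absorbs E v T}"
    if "F \<subseteq> V" "card F \<le> c / 16 * n" "v \<in> V" for F v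
    using many_absorbers[OF pairs_of_min_degree[OF deg \<alpha>(1) _ that(3)] \<alpha>(1) rho_small(2) n _ _ cG' that(1,2)]
      n6 n2 by (simp add: c_def)
  \<comment> \<open>The absorbing path has about \<open>8 * t\<close>, at most
    \<open>c / 32 * n\<close>, vertices; with \<open>R\<close> it still fits under the bound
    \<open>c / 16 * n\<close> of \<open>many\<close>.\<close>
  define t where "t = nat \<lfloor>c / 256 * n\<rfloor>"
  have t: "t \<le> c / 256 * n" "c / 256 * n - 1 \<le> t"
    using of_nat_floor[of "c / 256 * n"] real_of_int_floor_ge_diff_one[of "c / 256 * n"] c n
    by (simp_all add: t_def)
  have \<gamma>cn: "\<gamma> * n \<le> c / 4096 * n" using \<gamma>c n by (intro mult_right_mono) auto
  have size1: "8 * real t + 4 + card R \<le> c / 16 * n" using t R(3) n2 \<gamma>cn by linarith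
  have "c * n \<le> d / 4096 * n" using cd n by (intro mult_right_mono) auto
  then have size2: "c / 16 * n + 4 \<le> d / 8 * n" using n3 by simp
  have rho1: "\<rho> < d ^ 7 / 2 ^ 20"
  proof -
    have "d ^ 7 * \<gamma> ^ 3 \<le> d ^ 7 * 1" using d \<gamma> \<gamma>1 by (intro mult_left_mono) (auto simp: power_le_one)
    then show ?thesis using rho_small(1) by simp
  qed
  have "d ^ 3 * \<gamma> * n \<le> d ^ 3 * 1 * n" using d \<gamma>1 n by (intro mult_right_mono mult_left_mono) auto
  then have n1': "256 < d ^ 3 * n" using n1 by simp
  have "0 < c / 2" "c / 2 \<le> 1" using c c1 by auto
  from absorbing_path[OF R(1) n G GV rho1 n1' this many size1 size2]
  obtain A \<T> where A: "good_path G A" "set A \<subseteq> V - R" "finite \<T>" "length A = 8 * t + 4"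
    and sub: "\<forall>T\<in>\<T>. sublist (list4 T) A"
    and disj: "\<forall>T\<in>\<T>. \<forall>T'\<in>\<T>. T \<noteq> T' \<longrightarrow> set (list4 T) \<inter> set (list4 T') = {}"
    and pot: "(\<Sum>v\<in>V. (1/2) ^ card {T \<in> \<T>. absorbs E v T}) \<le> (1 - c / 2 / 2) ^ t * n"
    by blast
  \<comment> \<open>The least integer with \<open>4 \<le> k * (d / 8 * \<gamma>)\<close>. It does
    not depend on \<open>n\<close>, so blocks of this length fit once \<open>n\<close> is
    large.\<close>
  define k where "k = nat \<lceil>32 / (d * \<gamma>)\<rceil>"
  have d\<gamma>: "0 < d * \<gamma>" "d * \<gamma> \<le> 1" using d \<gamma> \<gamma>1 by (auto simp: mult_le_one)
  have k: "32 / (d * \<gamma>) \<le> k" "k \<le> 32 / (d * \<gamma>) + 1" using ceil[of "32 / (d * \<gamma>)"] d\<gamma> by (simp_all add: k_def)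
  have k1: "4 \<le> k * (d / 8 * \<gamma>)" using k(1) d\<gamma> by (simp add: field_simps)
  have "32 \<le> 32 / (d * \<gamma>)" using d\<gamma> by (simp add: field_simps)
  then have k2: "2 \<le> k" using k(1) by linarith
  have "k \<le> 32 / (d * \<gamma>) + 1 / (d * \<gamma>)"
    using d\<gamma> by (intro order.trans[OF k(2)] add_left_mono) simp
  also have "\<dots> = 33 / (d * \<gamma>)" by (simp flip: add_divide_distrib)
  also have "\<dots> \<le> d / 4 * (\<gamma> * n)" using n4 d\<gamma> by (simp add: field_simps power2_eq_square)
  finally have k3: "k \<le> d / 4 * (\<gamma> * n)" .
  from extend_to_cycle[OF R(1) \<gamma> R(2) n cG G GR \<eta> rho_small(1) n1 k2 k3 k1 A(1,2)]
  obtain B where B: "distinct (A @ B)" "tight_path E ((A @ B) @ take 2 (A @ B))" "set (A @ B) \<subseteq> V"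
    "card (V - set (A @ B)) \<le> \<gamma> * n + card R" by blast
  define L where "L = V - set (A @ B)"
  \<comment> \<open>A single summand \<open>(1/2) ^ m\<close> is at most the whole potential, which
    is at most \<open>exp (- (c / 4)) ^ t * n\<close>. Logarithms give \<open>m\<close> at least
    \<open>t * (c / 4) - ln n\<close>, which is linear in \<open>n\<close>.\<close>
  have L: "card L \<le> card {T \<in> \<T>. absorbs E v T}" if "v \<in> V" for v
  proof -
    define m where "m = card {T \<in> \<T>. absorbs E v T}"
    have "(1/2) ^ m \<le> (\<Sum>v\<in>V. (1/2 :: real) ^ card {T \<in> \<T>. absorbs E v T})"
      unfolding m_def using that by (intro member_le_sum) auto
    also have "\<dots> \<le> (1 - c / 2 / 2) ^ t * n" by (rule pot)
    also have "\<dots> \<le> exp (- (c / 4)) ^ t * n"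
      using exp_ge_add_one_self[of "- (c / 4)"] c1 n by (intro mult_right_mono power_mono) auto
    finally have "ln ((1/2) ^ m) \<le> ln (exp (- (c / 4)) ^ t * n)"
      using n by (subst ln_le_cancel_iff) auto
    moreover have "ln ((1/2 :: real) ^ m) = - (m * ln 2)"
      by (simp add: ln_realpow ln_div)
    moreover have "ln (exp (- (c / 4)) ^ t * n) = ln n - t * (c / 4)"
      using n by (subst ln_mult_pos) (simp_all add: ln_realpow)
    ultimately have "t * (c / 4) - ln n \<le> m * ln 2" by linarith
    also have "\<dots> \<le> real m * 1" using ln_2_less_1 by (intro mult_left_mono) auto
    finally have "t * (c / 4) - ln n \<le> m" by simp
    moreover have "(c / 256 * n - 1) * (c / 4) \<le> t * (c / 4)"
      using t(2) c by (intro mult_right_mono) auto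
    moreover have "(c / 256 * n - 1) * (c / 4) = 8 * (\<gamma> * n) - c / 4"
      by (simp add: \<gamma>_def power2_eq_square algebra_simps)
    ultimately have "3 * (\<gamma> * n) \<le> m" using n_large(2) c1 n5 by linarith
    moreover have "card L \<le> 3 * (\<gamma> * n)" using B(4) R(3) by (simp add: L_def)
    ultimately show ?thesis unfolding m_def by linarith
  qed
  have "\<exists>ys. distinct ys \<and> tight_path E (ys @ take 2 ys) \<and> set ys = set (A @ B) \<union> L"
  proof (rule absorb_all)
    show "sublist (list4 T) (A @ B)" if "T \<in> \<T>" for T
      using sub that by (auto simp: sublist_append)
    show "set (list4 T) \<inter> set (list4 T') = {}" if "T \<in> \<T>" "T' \<in> \<T>" "T \<noteq> T'" for T T'
      using disj that by blast
  qed (use A(3) B L in \<open>auto simp: L_def\<close>)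
  then obtain ys where ys: "distinct ys" "tight_path E (ys @ take 2 ys)" "set ys = V"
    using B(3) by (auto simp: L_def)
  have "2 \<le> length ys" using distinct_card[OF ys(1)] ys(3) n6 by simp
  then show ?thesis using tight_hamilton_cycleI[OF ys(1,2)] ys(3) by blast
qed

end

section \<open>Choice of \<open>\<rho>\<close> and \<open>n0\<close> from \<open>d\<close> and
  \<open>\<alpha>\<close>\<close>

theorem theorem1p2:
  fixes d \<alpha> :: real
  assumes "0 < d" "d \<le> 1" "0 < \<alpha>" "\<alpha> \<le> 1"
  shows "\<exists>(n0::nat) (\<rho>::real). 0 < \<rho> \<and> \<rho> \<le> 1 \<and>
    (\<forall>n\<ge>n0. \<forall>(V::'a set) E.
       three_graph V E \<and> card V = n \<and> cherry_dense \<rho> d V E \<and>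
       real (min_degree V E) \<ge> \<alpha> * real ((n - 1) choose 2) \<longrightarrow>
       (\<exists>xs. tight_hamilton_cycle V E xs))"
proof -
  define c where "c = d\<^sup>2 * \<alpha> ^ 3 / 4096"
  define \<gamma> where "\<gamma> = c\<^sup>2 / 8192"
  \<comment> \<open>The power \<open>2 ^ 21\<close> makes the bound with \<open>2 ^ 20\<close>
    strict, and 5120 is \<open>40 * 128\<close>.\<close>
  define \<rho> where "\<rho> = Min {d ^ 7 * \<gamma> ^ 3 / 2 ^ 21, d * \<alpha>\<^sup>2 / 512, d ^ 4 * \<gamma> ^ 4 / 5120, 1}"
  have \<gamma>: "0 < \<gamma>" using assms by (simp add: \<gamma>_def c_def)
  have \<rho>: "0 < \<rho>" "\<rho> \<le> 1" "\<rho> \<le> d ^ 7 * \<gamma> ^ 3 / 2 ^ 21" "\<rho> \<le> d * \<alpha>\<^sup>2 / 512" "\<rho> \<le> d ^ 4 * \<gamma> ^ 4 / 5120"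
    using assms \<gamma> by (auto simp: \<rho>_def)
  have "0 < d ^ 7 * \<gamma> ^ 3" using assms \<gamma> by simp
  then have \<rho>': "\<rho> < d ^ 7 * \<gamma> ^ 3 / 2 ^ 20" "40 * \<rho> \<le> d ^ 4 * \<gamma> ^ 4 / 128" using \<rho> by auto
  have "\<forall>\<^sub>F m in sequentially. 256 / (d ^ 3 * \<gamma>\<^sup>2) < real m"
    using filterlim_real_sequentially by (auto simp: filterlim_at_top_dense)
  moreover have "\<forall>\<^sub>F m in sequentially. 2 / \<gamma> < real m"
    using filterlim_real_sequentially by (auto simp: filterlim_at_top_dense)
  moreover have "\<forall>\<^sub>F m in sequentially. ln (real m) / real m < \<gamma> / 2"
    using order_tendstoD(2)[OF filterlim_compose[OF ln_x_over_x_tendsto_0 filterlim_real_sequentially],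
        of "\<gamma> / 2"] \<gamma> by simp
  ultimately have "\<forall>\<^sub>F m in sequentially. 256 < d ^ 3 * \<gamma>\<^sup>2 * real m \<and> ln (real m) + 1 < \<gamma> * real m"
  proof eventually_elim
    case (elim m)
    have "0 < d ^ 3 * \<gamma>\<^sup>2" using assms \<gamma> by simp
    then have "256 < d ^ 3 * \<gamma>\<^sup>2 * real m" using elim(1) by (simp add: field_simps)
    moreover have "0 < real m" using elim(2) \<gamma> divide_pos_pos[of 2 \<gamma>] by linarith
    then have "ln (real m) < \<gamma> * real m / 2" "2 < \<gamma> * real m"
      using elim(2,3) \<gamma> by (auto simp: field_simps)
    ultimately show ?case by simp
  qed
  then obtain n0 where n0: "\<And>m. n0 \<le> m \<Longrightarrow> 256 < d ^ 3 * \<gamma>\<^sup>2 * real m \<and> ln (real m) + 1 < \<gamma> * real m"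
    by (auto simp: eventually_sequentially)
  show ?thesis
  proof (intro exI[of _ n0] exI[of _ \<rho>] conjI allI impI)
    fix n and V :: "'a set" and E
    assume n: "n0 \<le> n" and *: "three_graph V E \<and> card V = n \<and> cherry_dense \<rho> d V E \<and>
       real (min_degree V E) \<ge> \<alpha> * real ((n - 1) choose 2)"
    interpret cherry_graph V E d \<rho>
      using * \<rho> assms by unfold_locales auto
    show "\<exists>xs. tight_hamilton_cycle V E xs"
      using tight_hamilton_cycle_exists[of \<alpha>] * n0[OF n] \<rho>(4) \<rho>' assms by (simp add: c_def \<gamma>_def)
  qed (use \<rho> in auto)
qed

end
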